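(* Consider the two-stage problem $\inf_{x\in\mathcal X}f_0(x)+\mathbb E[f(\xi,x)]$ with $$f(\xi,x)=\inf_y\{g(\xi,y): W_\xi y+T_\xi x=h_\xi,\ y\ge 0\},$$ and assume $|J|<\infty$, where $$|J|=\max_{\xi\in\Xi}\{\text{number of extreme rays of the cone }\{a:a^TW_\xi\ge0\}\}$$ (the sets of values of $W_\xi$ and $T_\xi$ may be infinite). Let $\xi^{[N]}=(\xi_1,\dots,\xi_N)$ be IID samples from $\mathbb P$ (so $\xi^{[N]}\sim\mathbb P^N$), and let $x^\star(\xi^{[N]})$ be the output of any algorithm that is guaranteed to be within the feasible region of SAA. Set $$d_{VC}=\frac{e}{(e-1)\log 2}\,|J|(n+1)\log\Big(\frac{e}{\log 2}\cdot|J|\Big).$$ Then, for any $0<\delta,\epsilon<1$, if $$N\ge\frac4\epsilon\Big(d_{VC}\log\big(\tfrac{12}{\epsilon}\big)+\log\big(\tfrac2\delta\big)\Big),$$ we have $\mathbb P^N\big(V(x^\star(\xi^{[N]}))>\epsilon\big)\le\delta$. Equivalently, in terms of convergence rate, $$\mathbb P^N\big(V(x^\star(\xi^{[N]}))>\epsilon\big)\le 2\exp\Big(-\frac{N\epsilon}{4}\Big)\Big(\frac{12}{\epsilon}\Big)^{d_{VC}}.$$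
   Context: Setting. $(\Omega,\mathcal F,\mathbb P)$ is a complete probability space and $\xi:\Omega\to\Xi\subseteq\mathbb R^r$ a random vector ($\mathbb P$ also denotes its law). $\mathcal X\subseteq\mathbb R^n$ is nonempty and closed. $f_0$ is a deterministic real-valued function of $x$. $W_\xi,T_\xi$ are matrices and $h_\xi$ a vector, of compatible sizes, depending on $\xi$. The function $g(\xi,\cdot)$ is convex and finite everywhere, for almost every $\xi\in\Xi$. The infimum over an empty set is $+\infty$. It is assumed that $f$ takes values in $\mathbb R\cup\{+\infty\}$, that $f(\xi,\cdot)$ is lower semicontinuous on $\mathcal X$, that $(\omega,x)\mapsto f(\xi(\omega),x)$ is measurable for the completion of $\mathcal F\otimes\mathscr B$ ($\mathscr B$ the Borel $\sigma$-algebra of $\mathcal X$), that the set of $x\in\mathcal X$ with finite objective $F(x)=f_0(x)+\mathbb E[f(\xi,x)]<+\infty$ is non-empty, and that all quantities of interest are measurable. The rows of each matrix $W_\xi$ are assumed linearly independent, so that each cone $\{a:a^TW_\xi\ge0\}$ is pointed and is minimally generated by its unique finite set of non-equivalent extreme rays (two rays are equivalent if they are positive multiples of each other); "number of extreme rays" counts non-equivalent ones. $\mathbb P^N$ is the joint law of $N$ IID samples of $\xi$. The SAA problem replaces $\mathbb E[f(\xi,x)]$ by $\frac1N\sum_{i=1}^N f(\xi_i,x)$; its feasible region is $\bigcap_{i=1}^N\{x\in\mathcal X:f(\xi_i,x)<+\infty\}$. The violation probability is $V(x)=\mathbb P(\xi\in\Xi:f(\xi,x)=+\infty)$ for $x\in\mathcal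 X$. $\log$ is the natural logarithm. *)

theory Defs
  imports "HOL-Probability.Probability"
begin

text \<open>Second-stage value function; the infimum over the empty set is \<open>\<infinity>\<close> in \<^typ>\<open>ereal\<close>.
  The order on \<^typ>\<open>real ^ 'p\<close> is componentwise.\<close>

definition recourse ::
  "('r \<Rightarrow> real^'p \<Rightarrow> ereal) \<Rightarrow> ('r \<Rightarrow> real^'p^'m) \<Rightarrow> ('r \<Rightarrow> real^'n^'m) \<Rightarrow> ('r \<Rightarrow> real^'m)
    \<Rightarrow> 'r \<Rightarrow> real^'n \<Rightarrow> ereal" where
  "recourse g W T h \<zeta> x = (INF y \<in> {y. W \<zeta> *v y + T \<zeta> *v x = h \<zeta> \<and> 0 \<le> y}. g \<zeta> y)"

text \<open>Linear independence of the indexed family of rows (so repeated rows are excluded).\<close>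

definition lin_indep_rows :: "real^'p^'m \<Rightarrow> bool" where
  "lin_indep_rows A \<longleftrightarrow> (\<forall>c. (\<Sum>i\<in>UNIV. c i *\<^sub>R row i A) = 0 \<longrightarrow> (\<forall>i. c i = 0))"

definition dual_cone_of :: "real^'p^'m \<Rightarrow> (real^'m) set" where
  "dual_cone_of A = {a. 0 \<le> a v* A}"

text \<open>Nonzero vectors spanning an extreme ray of a convex cone \<open>C\<close>.\<close>

definition extreme_directions :: "'a::real_vector set \<Rightarrow> 'a set" where
  "extreme_directions C = {a \<in> C. a \<noteq> 0 \<and>
     (\<forall>u\<in>C. \<forall>v\<in>C. a = u + v \<longrightarrow> (\<exists>s\<ge>0. \<exists>t\<ge>0. u = s *\<^sub>R a \<and> v = t *\<^sub>R a))}"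

definition ray_equiv :: "'a::real_vector set \<Rightarrow> ('a \<times> 'a) set" where
  "ray_equiv D = {(a, b). a \<in> D \<and> b \<in> D \<and> (\<exists>t>0. b = t *\<^sub>R a)}"

definition extreme_rays :: "'a::real_vector set \<Rightarrow> 'a set set" where
  "extreme_rays C = extreme_directions C // ray_equiv (extreme_directions C)"

text \<open>\<open>|J| < \<infinity>\<close>, and the value of \<open>|J|\<close>, which is meaningful only under this condition.\<close>

definition J_finite :: "('r \<Rightarrow> real^'p^'m) \<Rightarrow> 'r set \<Rightarrow> bool" where
  "J_finite W \<Xi> \<longleftrightarrow> (\<forall>\<zeta>\<in>\<Xi>. finite (extreme_rays (dual_cone_of (W \<zeta>)))) \<and>
     bdd_above ((\<lambda>\<zeta>. card (extreme_rays (dual_cone_of (W \<zeta>)))) ` \<Xi>)"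

definition J_card :: "('r \<Rightarrow> real^'p^'m) \<Rightarrow> 'r set \<Rightarrow> nat" where
  "J_card W \<Xi> = Max ((\<lambda>\<zeta>. card (extreme_rays (dual_cone_of (W \<zeta>)))) ` \<Xi>)"

text \<open>If \<open>k = 0\<close> (all cones are trivial) this is \<open>0\<close>, in agreement with \<open>0 log 0 = 0\<close>.\<close>

definition d_VC :: "nat \<Rightarrow> nat \<Rightarrow> real" where
  "d_VC k n = exp 1 / ((exp 1 - 1) * ln 2) * real k * (real n + 1) * ln (exp 1 / ln 2 * real k)"

text \<open>The law of \<open>\<xi>\<close> lives on \<open>\<Xi>\<close> with the trace of the Borel sets; \<open>\<Xi>\<close> need not be Borel.\<close>

definition law :: "'w measure \<Rightarrow> 'r::topological_space set \<Rightarrow> ('w \<Rightarrow> 'r) \<Rightarrow> 'r measure" where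
  "law M \<Xi> \<xi> = distr M (restrict_space borel \<Xi>) \<xi>"

definition sample_law ::
  "'w measure \<Rightarrow> 'r::topological_space set \<Rightarrow> ('w \<Rightarrow> 'r) \<Rightarrow> nat \<Rightarrow> (nat \<Rightarrow> 'r) measure" where
  "sample_law M \<Xi> \<xi> N = (\<Pi>\<^sub>M i\<in>{..<N}. law M \<Xi> \<xi>)"

text \<open>Expectation of an extended-real random variable as the difference of the integrals of its
  positive and negative parts. In \<^typ>\<open>ereal\<close>, \<open>\<infinity> - \<infinity> = \<infinity>\<close>, so the value is \<open>\<infinity>\<close> whenever the
  positive part is not integrable.\<close>

definition expectation_ereal :: "'w measure \<Rightarrow> ('w \<Rightarrow> ereal) \<Rightarrow> ereal" where
  "expectation_ereal M u =
     enn2ereal (\<integral>\<^sup>+\<omega>. e2ennreal (u \<omega>) \<partial>M) - enn2ereal (\<integral>\<^sup>+\<omega>. e2ennreal (- u \<omega>) \<partial>M)"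

definition objective ::
  "'w measure \<Rightarrow> ('w \<Rightarrow> 'r) \<Rightarrow> ('x \<Rightarrow> real) \<Rightarrow> ('r \<Rightarrow> 'x \<Rightarrow> ereal) \<Rightarrow> 'x \<Rightarrow> ereal" where
  "objective M \<xi> f0 f x = ereal (f0 x) + expectation_ereal M (\<lambda>\<omega>. f (\<xi> \<omega>) x)"

definition saa_feasible ::
  "('r \<Rightarrow> 'x \<Rightarrow> ereal) \<Rightarrow> 'x set \<Rightarrow> nat \<Rightarrow> (nat \<Rightarrow> 'r) \<Rightarrow> 'x set" where
  "saa_feasible f X N s = {x \<in> X. \<forall>i<N. f (s i) x < \<infinity>}"

definition violation :: "'w measure \<Rightarrow> ('w \<Rightarrow> 'r) \<Rightarrow> ('r \<Rightarrow> 'x \<Rightarrow> ereal) \<Rightarrow> 'x \<Rightarrow> real" where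
  "violation M \<xi> f x = measure M {\<omega> \<in> space M. f (\<xi> \<omega>) x = \<infinity>}"

definition lsc_on :: "'x::topological_space set \<Rightarrow> ('x \<Rightarrow> ereal) \<Rightarrow> bool" where
  "lsc_on X u \<longleftrightarrow> (\<forall>x\<in>X. u x \<le> Liminf (at x within X) u)"

end

theory Submission
  imports Defs
begin

text \<open>
  By Farkas' lemma and the Krein--Milman theorem, \<open>x\<close> is second-stage infeasible for \<open>\<zeta>\<close> iff
  \<open>a \<bullet> (h \<zeta> - T \<zeta> *v x) < 0\<close> for one of at most \<open>k = |J|\<close> representatives \<open>a\<close> of extreme rays. So the
  pattern of violated scenarios among \<open>2 N\<close> samples is determined by the position of \<open>x\<close> relative
  to \<open>2 N k\<close> half-spaces of \<open>\<real>\<^sup>n\<close>. A family of \<open>n + 1\<close> half-spaces cannot realise all \<open>2\<^sup>n\<^sup>+\<^sup>1\<close>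
  patterns (take a linear dependence of the normals), so by Sauer--Shelah there are at most
  \<open>\<Sum>j\<le>n. (2 N k) choose j\<close> patterns. The Vapnik--Chervonenkis double-sampling argument with random
  swaps bounds the probability by \<open>2 powr (1 - N \<epsilon> / 2)\<close> times this number. This is sharper than
  counting the patterns of \<open>k\<close>-fold unions of half-spaces; the slack in \<open>d_VC\<close> absorbs the rest.
\<close>

section \<open>Patterns cut out by half-spaces\<close>

definition shatters :: "'i set set \<Rightarrow> 'i set \<Rightarrow> bool" where
  "shatters F S \<longleftrightarrow> (\<forall>B\<subseteq>S. \<exists>Z\<in>F. Z \<inter> S = B)"

text \<open>Meant for the sets \<open>Z\<close> avoiding \<open>x\<close> such that both
  \<open>Z\<close> and \<open>insert x Z\<close> lie in \<open>F\<close>: a trace on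
  \<open>S\<close> can then be extended by either choice at \<open>x\<close>.\<close>

lemma shatters_insert:
  assumes F: "A \<subseteq> F" "\<And>Z. Z \<in> A \<Longrightarrow> x \<notin> Z" "insert x ` A \<subseteq> F" and S: "shatters A S" "x \<notin> S"
  shows "shatters F (insert x S)"
  unfolding shatters_def
proof (intro allI impI)
  fix B assume B: "B \<subseteq> insert x S"
  then have "B - {x} \<subseteq> S" by auto
  with S(1) obtain Z where Z: "Z \<in> A" "Z \<inter> S = B - {x}"
    unfolding shatters_def by meson
  show "\<exists>Z\<in>F. Z \<inter> insert x S = B"
  proof (cases "x \<in> B")
    case True
    then show ?thesis using Z F(2,3) S(2) by (intro bexI[of _ "insert x Z"]) auto
  next
    case False
    then show ?thesis using Z F(1,2) by (intro bexI[of _ Z]) auto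
  qed
qed

text \<open>Pajor's form of Sauer--Shelah, by induction on the ground set. Let \<open>A\<close> be
  the members avoiding \<open>x\<close>, and \<open>B\<close> the members containing
  \<open>x\<close>, with \<open>x\<close> removed. Then \<open>card F\<close> is
  \<open>card (A \<union> B) + card (A \<inter> B)\<close>. Whatever \<open>A \<union> B\<close>
  shatters, \<open>F\<close> shatters; whatever \<open>A \<inter> B\<close> shatters,
  \<open>F\<close> shatters with \<open>x\<close> added. The two kinds of sets are disjoint because
  only the second contains \<open>x\<close>.\<close>

lemma card_le_card_shattered:
  assumes "finite I" "F \<subseteq> Pow I"
  shows "card F \<le> card {S. S \<subseteq> I \<and> shatters F S}"
  using assms
proof (induction I arbitrary: F rule: finite_induct)
  case empty
  show ?case
  proof (cases "F = {}")
    case False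
    with empty have "F = {{}}" by auto
    moreover from this have "{S. S \<subseteq> {} \<and> shatters F S} = {{}}"
      by (auto simp: shatters_def)
    ultimately show ?thesis by simp
  qed simp
next
  case (insert x I)
  define A where "A = {Z \<in> F. x \<notin> Z}"
  define B where "B = {Z. x \<notin> Z \<and> insert x Z \<in> F}"
  have AB: "A \<subseteq> Pow I" "B \<subseteq> Pow I"
    using insert.prems by (auto simp: A_def B_def)
  have fin: "finite A" "finite B"
    using AB insert.hyps(1) by (auto intro: finite_subset)
  have F_eq: "F = A \<union> insert x ` B"
  proof
    show "F \<subseteq> A \<union> insert x ` B"
    proof
      fix Z assume Z: "Z \<in> F"
      show "Z \<in> A \<union> insert x ` B"
      proof (cases "x \<in> Z")
        case True
        then have "Z = insert x (Z - {x})" "Z - {x} \<in> B"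
          using Z by (auto simp: B_def insert_absorb)
        then show ?thesis by blast
      qed (use Z in \<open>auto simp: A_def\<close>)
    qed
  qed (auto simp: A_def B_def)
  have "card F = card A + card (insert x ` B)"
    unfolding F_eq by (rule card_Un_disjoint) (use fin in \<open>auto simp: A_def\<close>)
  also have "card (insert x ` B) = card B"
    by (rule card_image) (auto simp: inj_on_def B_def)
  also have "card A + card B = card (A \<union> B) + card (A \<inter> B)"
    using fin by (rule card_Un_Int)
  also have "\<dots> \<le> card {S. S \<subseteq> I \<and> shatters (A \<union> B) S} + card {S. S \<subseteq> I \<and> shatters (A \<inter> B) S}"
    using AB by (intro add_mono insert.IH) auto
  also have "card {S. S \<subseteq> I \<and> shatters (A \<inter> B) S} = card (insert x ` {S. S \<subseteq> I \<and> shatters (A \<inter> B) S})"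
    using insert.hyps(2) by (intro card_image[symmetric]) (auto simp: inj_on_def)
  also have "card {S. S \<subseteq> I \<and> shatters (A \<union> B) S} + \<dots> =
      card ({S. S \<subseteq> I \<and> shatters (A \<union> B) S} \<union> insert x ` {S. S \<subseteq> I \<and> shatters (A \<inter> B) S})"
    using insert.hyps by (intro card_Un_disjoint[symmetric]) auto
  also have "\<dots> \<le> card {S. S \<subseteq> insert x I \<and> shatters F S}"
  proof (rule card_mono)
    have "shatters F S" if "S \<subseteq> I" "shatters (A \<union> B) S" for S
      unfolding shatters_def
    proof (intro allI impI)
      fix C assume "C \<subseteq> S"
      with that obtain Z where Z: "Z \<in> A \<union> B" "Z \<inter> S = C"
        unfolding shatters_def by meson
      from Z(1) show "\<exists>Z\<in>F. Z \<inter> S = C"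
      proof
        assume "Z \<in> B"
        with Z(2) that(1) insert.hyps(2) show ?thesis
          by (intro bexI[of _ "insert x Z"]) (auto simp: B_def)
      qed (use Z(2) in \<open>auto simp: A_def\<close>)
    qed
    moreover have "shatters F (insert x S)" if "S \<subseteq> I" "shatters (A \<inter> B) S" for S
      using that insert.hyps(2) by (intro shatters_insert[of "A \<inter> B"]) (auto simp: A_def B_def)
    ultimately show "{S. S \<subseteq> I \<and> shatters (A \<union> B) S} \<union> insert x ` {S. S \<subseteq> I \<and> shatters (A \<inter> B) S}
        \<subseteq> {S. S \<subseteq> insert x I \<and> shatters F S}"
      by auto
  qed (use insert.hyps(1) in simp)
  finally show ?case .
qed

lemma sauer_shelah:
  assumes "finite I" "F \<subseteq> Pow I" and VC: "\<And>S. S \<subseteq> I \<Longrightarrow> shatters F S \<Longrightarrow> card S \<le> d"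
  shows "card F \<le> (\<Sum>j\<le>d. card I choose j)"
proof -
  have "card F \<le> card {S. S \<subseteq> I \<and> shatters F S}"
    using assms(1,2) by (rule card_le_card_shattered)
  also have "\<dots> \<le> card (\<Union>j\<le>d. {S. S \<subseteq> I \<and> card S = j})"
    using assms by (intro card_mono) (auto intro: finite_subset[of _ "Pow I"])
  also have "\<dots> \<le> (\<Sum>j\<le>d. card {S. S \<subseteq> I \<and> card S = j})"
    by (rule card_UN_le) simp
  also have "\<dots> = (\<Sum>j\<le>d. card I choose j)"
    using assms(1) by (simp add: n_subsets)
  finally show ?thesis .
qed

section \<open>Half-spaces as the ground set, points as the family\<close>

text \<open>Stated for indexed families because normals of different half-spaces may coincide; a
  repeated vector gives the dependence with coefficients 1 and -1.\<close>

lemma linear_dependence_family: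
  fixes c :: "'i \<Rightarrow> 'a::euclidean_space"
  assumes "finite S" "DIM('a) < card S"
  obtains u j where "j \<in> S" "u j \<noteq> 0" "(\<Sum>i\<in>S. u i *\<^sub>R c i) = 0"
proof (cases "inj_on c S")
  case True
  then have "dependent (c ` S)"
    using assms by (intro dependent_biggerset) (simp add: card_image)
  then obtain u v where u: "(\<Sum>v\<in>c ` S. u v *\<^sub>R v) = 0" "v \<in> c ` S" "u v \<noteq> 0"
    using assms(1) by (auto simp: dependent_finite)
  from u(2) obtain j where "j \<in> S" "v = c j" by auto
  then show thesis
    using that[of j "u \<circ> c"] u True by (simp add: sum.reindex)
next
  case False
  then obtain i j where ij: "i \<in> S" "j \<in> S" "i \<noteq> j" "c i = c j"
    by (auto simp: inj_on_def)
  let ?u = "\<lambda>k. if k = i then 1 else if k = j then -1 else (0::real)"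
  have "(\<Sum>k\<in>S. ?u k *\<^sub>R c k) = (\<Sum>k\<in>{i, j}. ?u k *\<^sub>R c k)"
    using assms(1) ij by (intro sum.mono_neutral_right) auto
  also have "\<dots> = 0" using ij by simp
  finally show thesis using that[of i ?u] ij by simp
qed

text \<open>More than \<open>DIM('a)\<close> normals have a dependence \<open>u\<close>, and then
  the slacks \<open>c i \<bullet> x - b i\<close> weighted by \<open>u\<close> have a sum
  \<open>- C\<close> that does not depend on \<open>x\<close>. Realising the pattern
  \<open>{i \<in> S. 0 < t * u i}\<close> makes every term of \<open>t\<close> times this sum
  nonnegative, and some term positive if the pattern is nonempty. For \<open>t = 1\<close> and
  \<open>t = -1\<close> this yields incompatible signs of \<open>C\<close>.\<close>

lemma card_shattered_by_halfspaces_le: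
  fixes c :: "'i \<Rightarrow> 'a::euclidean_space"
  assumes "finite I" "S \<subseteq> I" and shat: "shatters ((\<lambda>x. {i \<in> I. b i < c i \<bullet> x}) ` X) S"
  shows "card S \<le> DIM('a)"
proof (rule ccontr)
  assume "\<not> card S \<le> DIM('a)"
  then have card: "DIM('a) < card S" by simp
  have S: "finite S" using assms(2,1) by (rule finite_subset)
  obtain u j where u: "j \<in> S" "u j \<noteq> 0" "(\<Sum>i\<in>S. u i *\<^sub>R c i) = 0"
    by (rule linear_dependence_family[OF S card])
  define C where "C = (\<Sum>i\<in>S. u i * b i)"
  have sum_eq: "(\<Sum>i\<in>S. u i * (c i \<bullet> x - b i)) = - C" for x
  proof -
    have "(\<Sum>i\<in>S. u i * (c i \<bullet> x)) = (\<Sum>i\<in>S. u i *\<^sub>R c i) \<bullet> x"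
      by (simp add: inner_sum_left)
    then show ?thesis using u(3) by (simp add: C_def right_diff_distrib sum_subtractf)
  qed
  have real_pattern: "\<exists>x. \<forall>i\<in>S. b i < c i \<bullet> x \<longleftrightarrow> i \<in> B" if B: "B \<subseteq> S" for B
  proof -
    obtain x where x: "{i \<in> I. b i < c i \<bullet> x} \<inter> S = B"
      using shat B unfolding shatters_def by blast
    show ?thesis using x assms(2) by (intro exI[of _ x]) blast
  qed
  have key: "0 \<le> - t * C \<and> ((\<exists>i\<in>S. 0 < t * u i) \<longrightarrow> 0 < - t * C)" for t :: real
  proof -
    obtain x where x: "\<forall>i\<in>S. b i < c i \<bullet> x \<longleftrightarrow> i \<in> {i \<in> S. 0 < t * u i}"
      using real_pattern[of "{i \<in> S. 0 < t * u i}"] by auto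
    have eq: "- t * C = (\<Sum>i\<in>S. (t * u i) * (c i \<bullet> x - b i))"
      using sum_eq[of x] by (simp add: mult.assoc flip: sum_distrib_left)
    have nn: "0 \<le> (t * u i) * (c i \<bullet> x - b i)" if "i \<in> S" for i
    proof (cases "0 < t * u i")
      case True
      then have "b i < c i \<bullet> x" using x that by blast
      with True show ?thesis by (intro mult_nonneg_nonneg[of "t * u i"]) linarith+
    next
      case False
      then have "\<not> b i < c i \<bullet> x" using x that by blast
      with False show ?thesis by (intro mult_nonpos_nonpos[of "t * u i"]) linarith+
    qed
    have "0 < - t * C" if "i \<in> S" "0 < t * u i" for i
      unfolding eq
    proof (rule sum_pos2[OF S that(1) _ nn])
      show "0 < t * u i * (c i \<bullet> x - b i)"
      proof (rule mult_pos_pos[OF that(2)])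
        show "0 < c i \<bullet> x - b i" using x that by simp
      qed
    qed
    moreover have "0 \<le> - t * C" unfolding eq using nn by (rule sum_nonneg)
    ultimately show ?thesis by blast
  qed
  from u(2) consider "0 < 1 * u j" | "0 < - 1 * u j" by linarith
  then show False
  proof cases
    case 1
    with u(1) have "0 < - 1 * C" using key[of 1] by blast
    with key[of "- 1"] show False by simp
  next
    case 2
    with u(1) have "0 < - (- 1) * C" using key[of "- 1"] by blast
    with key[of 1] show False by simp
  qed
qed

lemma card_halfspace_patterns_le:
  fixes c :: "'i \<Rightarrow> 'a::euclidean_space"
  assumes "finite I"
  shows "card ((\<lambda>x. {i \<in> I. b i < c i \<bullet> x}) ` X) \<le> (\<Sum>j\<le>DIM('a). card I choose j)"
proof (rule sauer_shelah[OF assms])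
  show "(\<lambda>x. {i \<in> I. b i < c i \<bullet> x}) ` X \<subseteq> Pow I" by auto
qed (rule card_shattered_by_halfspaces_le[OF assms])

text \<open>Multiply by \<open>t ^ n\<close>: since \<open>t \<le> 1\<close>, the weight
  \<open>t ^ n\<close> may be raised to \<open>t ^ j\<close>, and completing the sum gives
  \<open>(t + 1) ^ m\<close>. The parameter stays free, to be matched to \<open>\<epsilon>\<close>
  later.\<close>

lemma binomial_partial_sum_le:
  fixes t :: real
  assumes "0 < t" "t \<le> 1"
  shows "real (\<Sum>j\<le>n. m choose j) \<le> exp (t * real m) / t ^ n"
proof -
  have "t ^ n * real (\<Sum>j\<le>n. m choose j) = (\<Sum>j\<le>n. real (m choose j) * t ^ n)"
    by (simp add: sum_distrib_left mult.commute)
  also have "\<dots> \<le> (\<Sum>j\<le>n. real (m choose j) * t ^ j)"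
    using assms by (intro sum_mono mult_left_mono power_decreasing) auto
  also have "\<dots> = (\<Sum>j\<in>{..n} \<inter> {..m}. real (m choose j) * t ^ j)"
    by (rule sum.mono_neutral_right) (auto simp: not_le binomial_eq_0)
  also have "\<dots> \<le> (\<Sum>j\<le>m. real (m choose j) * t ^ j)"
    using assms by (intro sum_mono2) auto
  also have "\<dots> = (t + 1) ^ m"
    by (simp add: binomial_ring)
  also have "\<dots> \<le> exp t ^ m"
    using assms by (intro power_mono) (simp_all add: add.commute exp_ge_add_one_self)
  also have "\<dots> = exp (t * real m)"
    by (metis exp_of_nat_mult mult.commute)
  finally show ?thesis
    using assms by (simp add: field_simps)
qed

section \<open>Double sampling\<close>

text \<open>Exchanges the positions \<open>i\<close> and \<open>i + N\<close> for
  \<open>i \<in> U\<close>. Permutations that only act inside such pairs suffice for the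
  symmetrisation, and they make the counting elementary.\<close>

definition swap_halves :: "nat \<Rightarrow> nat set \<Rightarrow> nat \<Rightarrow> nat" where
  "swap_halves N U i = (if i < N then (if i \<in> U then i + N else i)
     else (if i - N \<in> U then i - N else i))"

lemma swap_halves_involutive: "U \<subseteq> {..<N} \<Longrightarrow> swap_halves N U (swap_halves N U i) = i"
  by (auto simp: swap_halves_def)

lemma inj_swap_halves: "U \<subseteq> {..<N} \<Longrightarrow> inj (swap_halves N U)"
  by (metis injI swap_halves_involutive)

lemma swap_halves_less: "i < 2 * N \<Longrightarrow> swap_halves N U i < 2 * N"
  by (auto simp: swap_halves_def)

text \<open>\<open>D\<close> collects the pairs that meet \<open>Z\<close>. A swap that keeps the
  first half free of \<open>Z\<close> has no choice on such a pair: it must exchange it exactly when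
  its first point lies in \<open>Z\<close>. So \<open>U\<close> is determined by
  \<open>U - D\<close>, which leaves \<open>2 ^ (N - card D)\<close> possibilities, and the second
  half contains at most \<open>card D\<close> hits.\<close>

lemma card_swaps_le:
  fixes a :: real
  assumes Z: "Z \<subseteq> {..<2 * N}"
  shows "real (card {U. U \<subseteq> {..<N} \<and> (\<forall>i<N. swap_halves N U i \<notin> Z) \<and>
      a \<le> real (card {i \<in> {N..<2 * N}. swap_halves N U i \<in> Z})}) \<le> 2 ^ N * 2 powr (- a)"
    (is "real (card ?A) \<le> _")
proof (cases "?A = {}")
  case True
  then show ?thesis by (simp only: card.empty) simp
next
  case False
  define D where "D = {i \<in> {..<N}. i \<in> Z \<or> i + N \<in> Z}"
  have D: "D \<subseteq> {..<N}" by (auto simp: D_def)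
  have trace: "U \<inter> D = Z \<inter> D" if "U \<in> ?A" for U
  proof -
    have "i \<in> U \<longleftrightarrow> i \<in> Z" if i: "i \<in> D" for i
    proof -
      from i have "i < N" "i \<in> Z \<or> i + N \<in> Z" by (simp_all add: D_def)
      moreover from this(1) \<open>U \<in> ?A\<close> have "swap_halves N U i \<notin> Z" by blast
      ultimately show ?thesis by (cases "i \<in> U") (simp_all add: swap_halves_def)
    qed
    then show ?thesis by auto
  qed
  have "inj_on (\<lambda>U. U - D) ?A"
  proof (rule inj_onI)
    fix U V assume U: "U \<in> ?A" and V: "V \<in> ?A" and eq: "U - D = V - D"
    have "U \<inter> D = V \<inter> D" unfolding trace[OF U] trace[OF V] ..
    with eq show "U = V" by blast
  qed
  moreover have "(\<lambda>U. U - D) ` ?A \<subseteq> Pow ({..<N} - D)"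
    by (rule image_subsetI) blast
  ultimately have "card ?A \<le> card (Pow ({..<N} - D))"
    by (rule card_inj_on_le) simp
  also have "\<dots> = 2 ^ (N - card D)"
    using D by (simp add: card_Pow card_Diff_subset finite_subset)
  finally have "real (card ?A) \<le> real (2 ^ (N - card D))"
    by (rule of_nat_mono)
  also have "\<dots> = 2 powr real (N - card D)"
    by (simp add: powr_realpow)
  also have "real (N - card D) = real N - real (card D)"
    using card_mono[OF _ D] by (simp add: of_nat_diff)
  also have "2 powr (real N - real (card D)) \<le> 2 powr (real N - a)"
  proof -
    \<comment> \<open>Comparing \<open>a\<close> with \<open>card D\<close> requires one actual
      member of the set, hence the separate treatment of the empty case.\<close>
    obtain U where U: "U \<subseteq> {..<N}" "a \<le> real (card {i \<in> {N..<2 * N}. swap_halves N U i \<in> Z})"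
      using False by auto
    have "(\<lambda>i. i - N) ` {i \<in> {N..<2 * N}. swap_halves N U i \<in> Z} \<subseteq> D"
      by (auto simp: D_def swap_halves_def split: if_splits)
    moreover have "inj_on (\<lambda>i. i - N) {i \<in> {N..<2 * N}. swap_halves N U i \<in> Z}"
      by (auto simp: inj_on_def)
    moreover have "finite D" using D by (rule finite_subset) simp
    ultimately have "card {i \<in> {N..<2 * N}. swap_halves N U i \<in> Z} \<le> card D"
      by (intro card_inj_on_le)
    then show ?thesis using U(2) by (intro powr_mono) auto
  qed
  also have "\<dots> = 2 ^ N * 2 powr (- a)"
    using powr_add[of 2 "real N" "- a"] by (simp add: powr_realpow)
  finally show ?thesis .
qed

section \<open>Symmetrisation with a second sample\<close>

text \<open>An exponential Markov bound in base 2: with \<open>a\<close> half of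
  \<open>card J * \<epsilon>\<close>, the indicator of fewer than \<open>a\<close> hits is at most 2
  to the power \<open>a\<close> minus the number of hits, whose expectation factorises over
  \<open>J\<close>.\<close>

lemma (in prob_space) hits_lower_tail:
  fixes \<epsilon> :: real
  assumes J: "finite J" and Q[measurable]: "Measurable.pred M Q"
    and prob: "\<epsilon> < prob {z \<in> space M. Q z}" and large: "5 \<le> real (card J) * \<epsilon>"
  shows "1 / 2 \<le> measure (PiM J (\<lambda>_. M))
    {s \<in> space (PiM J (\<lambda>_. M)). real (card J) * \<epsilon> / 2 \<le> (\<Sum>i\<in>J. of_bool (Q (s i)))}"
proof -
  interpret P: product_prob_space "\<lambda>_. M" J ..
  let ?P = "PiM J (\<lambda>_. M)"
  define a where "a = real (card J) * \<epsilon> / 2"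
  define p where "p = prob {z \<in> space M. Q z}"
  \<comment> \<open>This is 2 to the power of minus the indicator of \<open>Q\<close>, written
    affinely so that its integral is visibly \<open>1 - p / 2\<close>.\<close>
  define w where "w = (\<lambda>z. 1 - 1 / 2 * indicator {z \<in> space M. Q z} z :: real)"
  have [measurable]: "{z \<in> space M. Q z} \<in> sets M" by simp
  have w_int: "integrable M w"
    unfolding w_def by (intro Bochner_Integration.integrable_diff integrable_mult_right integrable_real_indicator)
      (auto simp: less_top[symmetric])
  have w_eq: "(\<integral>z. w z \<partial>M) = 1 - p / 2"
    unfolding w_def p_def
    by (subst Bochner_Integration.integral_diff)
      (auto simp: prob_space less_top[symmetric] intro!: integrable_mult_right integrable_real_indicator)
  define bad where "bad = {s \<in> space ?P. (\<Sum>i\<in>J. of_bool (Q (s i))) < a}"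
  have [measurable]: "(\<lambda>s. \<Sum>i\<in>J. of_bool (Q (s i)) :: real) \<in> borel_measurable ?P"
    unfolding of_bool_def by measurable
  have bad[measurable]: "bad \<in> sets ?P" unfolding bad_def by measurable
  have prod_int: "integrable ?P (\<lambda>s. \<Prod>i\<in>J. w (s i))"
    by (rule P.product_integrable_prod[OF J w_int])
  have "measure ?P bad = (\<integral>s. indicator bad s \<partial>?P)"
    by simp
  also have "\<dots> \<le> (\<integral>s. 2 powr a * (\<Prod>i\<in>J. w (s i)) \<partial>?P)"
  proof (rule integral_mono)
    fix s assume s: "s \<in> space ?P"
    have "w (s i) = 2 powr (- of_bool (Q (s i)))" if "i \<in> J" for i
      using s that by (auto simp: w_def space_PiM PiE_iff powr_minus)
    then have "2 powr a * (\<Prod>i\<in>J. w (s i)) = 2 powr a * (\<Prod>i\<in>J. 2 powr (- of_bool (Q (s i))))"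
      by (metis (no_types, lifting) prod.cong)
    also have "\<dots> = 2 powr (a - (\<Sum>i\<in>J. of_bool (Q (s i))))"
      using J powr_add[of 2 a "- (\<Sum>i\<in>J. of_bool (Q (s i)))"]
      by (simp add: sum_negf flip: powr_sum)
    finally have eq: "2 powr a * (\<Prod>i\<in>J. w (s i)) = 2 powr (a - (\<Sum>i\<in>J. of_bool (Q (s i))))" .
    show "indicator bad s \<le> 2 powr a * (\<Prod>i\<in>J. w (s i))"
      unfolding eq by (auto simp: bad_def indicator_def intro!: ge_one_powr_ge_zero)
  qed (use prod_int bad in \<open>auto intro: integrable_real_indicator simp: less_top[symmetric]\<close>)
  also have "\<dots> = 2 powr a * (1 - p / 2) ^ card J"
    using P.product_integral_prod[OF J, of "\<lambda>_. w"] w_int w_eq by simp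
  also have "\<dots> \<le> 2 powr a * exp (- (p / 2)) ^ card J"
    using exp_ge_add_one_self[of "- (p / 2)"] order_trans[OF prob_le_1 one_le_numeral]
    by (intro mult_left_mono power_mono) (simp_all add: p_def)
  also have "\<dots> = exp (a * ln 2 - real (card J) * p / 2)"
    using exp_of_nat_mult[of "card J" "- (p / 2)"] exp_add[of "a * ln 2" "- (real (card J) * p / 2)"]
    by (simp add: powr_def)
  also have "\<dots> \<le> exp (- ln 2)"
  \<comment> \<open>Here \<open>a \<ge> 5 / 2\<close> and \<open>ln 2 \<le> 25 / 36\<close>, so the
    exponent is at most \<open>- a * (11 / 36)\<close>, hence at most -55/72, which lies below
    -25/36. This is the origin of the constant 5.\<close>
  proof -
    have "real (card J) * \<epsilon> \<le> real (card J) * p"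
      using prob by (intro mult_left_mono) (auto simp: p_def)
    moreover have "a * ln 2 \<le> a * (25 / 36)"
      using ln2_le_25_over_36 large by (intro mult_left_mono) (auto simp: a_def)
    ultimately have "a * ln 2 - real (card J) * p / 2 \<le> - ln 2"
      using large ln2_le_25_over_36 a_def by linarith
    then show ?thesis by simp
  qed
  also have "\<dots> = 1 / 2" by (simp add: exp_minus)
  finally have "measure ?P bad \<le> 1 / 2" .
  moreover have "{s \<in> space ?P. a \<le> (\<Sum>i\<in>J. of_bool (Q (s i)))} = space ?P - bad"
    by (auto simp: bad_def)
  ultimately show ?thesis
    unfolding a_def[symmetric] using P.prob_compl[OF bad] by simp
qed

text \<open>The selected point depends on the first half only. With a first half in \<open>A\<close>
  held fixed, the second half is an independent sample tested at a fixed point, so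
  \<open>hits_lower_tail\<close> gives conditional probability at least 1/2 to the event in
  \<open>C\<close>. Integrating over the first half costs the factor 2.\<close>

lemma (in prob_space) double_sampling:
  fixes \<epsilon> :: real and S :: "'x measure"
  assumes Q[measurable]: "Measurable.pred (M \<Otimes>\<^sub>M S) (\<lambda>(z, x). Q z x)"
    and sel[measurable]: "xs \<in> PiM {..<N} (\<lambda>_. M) \<rightarrow>\<^sub>M S"
    and large: "5 \<le> real N * \<epsilon>"
  defines "A \<equiv> {s \<in> space (PiM {..<N} (\<lambda>_. M)). \<epsilon> < prob {z \<in> space M. Q z (xs s)} \<and>
    (\<forall>i<N. \<not> Q (s i) (xs s))}"
    and "C \<equiv> {s \<in> space (PiM {..<2 * N} (\<lambda>_. M)). (\<forall>i<N. \<not> Q (s i) (xs (restrict s {..<N}))) \<and>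
      real N * \<epsilon> / 2 \<le> (\<Sum>i\<in>{N..<2 * N}. of_bool (Q (s i) (xs (restrict s {..<N}))))}"
  assumes A: "A \<in> sets (PiM {..<N} (\<lambda>_. M))"
  shows "C \<in> sets (PiM {..<2 * N} (\<lambda>_. M))"
    and "measure (PiM {..<N} (\<lambda>_. M)) A \<le> 2 * measure (PiM {..<2 * N} (\<lambda>_. M)) C"
proof -
  interpret P: product_prob_space "\<lambda>_. M" "{..<2 * N} :: nat set" ..
  interpret P1: product_prob_space "\<lambda>_. M" "{..<N} :: nat set" ..
  interpret P2: product_prob_space "\<lambda>_. M" "{N..<2 * N} :: nat set" ..
  let ?P = "PiM {..<2 * N} (\<lambda>_. M)"
  let ?P1 = "PiM {..<N} (\<lambda>_. M)"
  let ?P2 = "PiM {N..<2 * N} (\<lambda>_. M)"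
  have un: "{..<2 * N} = {..<N} \<union> {N..<2 * N}" and disj: "{..<N} \<inter> {N..<2 * N} = {}" by auto
  have restr: "(\<lambda>s. xs (restrict s {..<N})) \<in> ?P \<rightarrow>\<^sub>M S"
    by (rule measurable_compose[OF measurable_restrict_subset sel]) auto
  have Q_i[measurable]: "Measurable.pred ?P (\<lambda>s. Q (s i) (xs (restrict s {..<N})))" if "i < 2 * N" for i
  proof -
    have "(\<lambda>s. (s i, xs (restrict s {..<N}))) \<in> ?P \<rightarrow>\<^sub>M M \<Otimes>\<^sub>M S"
      using that restr by (intro measurable_Pair measurable_component_singleton) auto
    from measurable_compose[OF this Q] show ?thesis by simp
  qed
  have sum_meas[measurable]: "(\<lambda>s. \<Sum>i\<in>{N..<2 * N}. of_bool (Q (s i) (xs (restrict s {..<N}))) :: real)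
      \<in> borel_measurable ?P"
    unfolding of_bool_def by (intro borel_measurable_sum measurable_If) auto
  have "Measurable.pred ?P (\<lambda>s. \<forall>i\<in>{..<N}. \<not> Q (s i) (xs (restrict s {..<N})))"
    by (intro pred_intros_finite pred_intros_logic Q_i) auto
  then have [measurable]: "Measurable.pred ?P (\<lambda>s. \<forall>i<N. \<not> Q (s i) (xs (restrict s {..<N})))"
    by (simp add: Ball_def)
  show C: "C \<in> sets ?P" unfolding C_def by measurable
  have "ennreal (1 / 2) * emeasure ?P1 A = (\<integral>\<^sup>+s. ennreal (1 / 2) * indicator A s \<partial>?P1)"
    using A by (simp add: nn_integral_cmult_indicator)
  also have "\<dots> \<le> (\<integral>\<^sup>+s. (\<integral>\<^sup>+t. indicator C (merge {..<N} {N..<2 * N} (s, t)) \<partial>?P2) \<partial>?P1)"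
  proof (rule nn_integral_mono)
    fix s assume s: "s \<in> space ?P1"
    show "ennreal (1 / 2) * indicator A s \<le> (\<integral>\<^sup>+t. indicator C (merge {..<N} {N..<2 * N} (s, t)) \<partial>?P2)"
    proof (cases "s \<in> A")
      case True
      let ?x = "xs s"
      have x: "?x \<in> space S" using sel s by (rule measurable_space)
      have Qx[measurable]: "Measurable.pred M (\<lambda>z. Q z ?x)"
        using measurable_compose[OF measurable_Pair2'[OF x] Q] by simp
      have merge_s: "restrict (merge {..<N} {N..<2 * N} (s, t)) {..<N} = s" for t
        using s by (auto simp: space_PiM merge_def PiE_def extensional_def restrict_def)
      let ?H = "{t \<in> space ?P2. real N * \<epsilon> / 2 \<le> (\<Sum>i\<in>{N..<2 * N}. of_bool (Q (t i) ?x))}"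
      have "1 / 2 \<le> measure ?P2 ?H"
        using hits_lower_tail[of "{N..<2 * N}" "\<lambda>z. Q z ?x" \<epsilon>] True large Qx by (simp add: A_def)
      then have "ennreal (1 / 2) \<le> emeasure ?P2 ?H"
        unfolding P2.emeasure_eq_measure by (rule ennreal_leI)
      also have "\<dots> = (\<integral>\<^sup>+t. indicator ?H t \<partial>?P2)"
      proof -
        have "(\<lambda>t. \<Sum>i\<in>{N..<2 * N}. of_bool (Q (t i) ?x) :: real) \<in> borel_measurable ?P2"
          unfolding of_bool_def by measurable
        then have "?H \<in> sets ?P2" by measurable
        then show ?thesis by simp
      qed
      also have "\<dots> \<le> (\<integral>\<^sup>+t. indicator C (merge {..<N} {N..<2 * N} (s, t)) \<partial>?P2)"
      proof (rule nn_integral_mono)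
        fix t assume t: "t \<in> space ?P2"
        have "merge {..<N} {N..<2 * N} (s, t) \<in> C" if "t \<in> ?H"
        proof -
          have "merge {..<N} {N..<2 * N} (s, t) \<in> space ?P"
            using s t by (auto simp: space_PiM PiE_iff merge_def extensional_def)
          moreover have "(\<Sum>i\<in>{N..<2 * N}. of_bool (Q (merge {..<N} {N..<2 * N} (s, t) i) ?x) :: real)
              = (\<Sum>i\<in>{N..<2 * N}. of_bool (Q (t i) ?x))"
            by (intro sum.cong) (auto simp: merge_def)
          moreover have "\<not> Q (merge {..<N} {N..<2 * N} (s, t) i) ?x" if "i < N" for i
            using that True by (simp add: merge_def A_def)
          ultimately show ?thesis using \<open>t \<in> ?H\<close> by (simp add: C_def merge_s)
        qed
        then show "indicator ?H t \<le> (indicator C (merge {..<N} {N..<2 * N} (s, t)) :: ennreal)"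
          by (auto simp: indicator_def)
      qed
      finally show ?thesis using True by simp
    qed simp
  qed
  also have "\<dots> = (\<integral>\<^sup>+z. indicator C z \<partial>?P)"
    using C unfolding un by (subst P.product_nn_integral_fold[OF disj]) auto
  also have "\<dots> = emeasure ?P C" using C by simp
  finally have "ennreal (1 / 2) * emeasure ?P1 A \<le> emeasure ?P C" .
  then have "ennreal (1 / 2 * measure ?P1 A) \<le> ennreal (measure ?P C)"
    by (simp only: P1.emeasure_eq_measure P.emeasure_eq_measure ennreal_mult' measure_nonneg)
  then show "measure ?P1 A \<le> 2 * measure ?P C"
    by (simp add: ennreal_le_iff)
qed

text \<open>Averaging over the \<open>2 ^ N\<close> swaps turns the probability into a count that is bounded for
  every fixed double sample, so only the measurable event itself enters, never a supremum over \<open>x\<close>.\<close>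

lemma (in prob_space) swap_bound:
  fixes a :: real and N :: nat
  assumes C: "C \<in> sets (PiM {..<2 * N} (\<lambda>_. M))"
    and C_witness: "\<And>s. s \<in> C \<Longrightarrow> \<exists>x\<in>X. (\<forall>i<N. \<not> Q (s i) x) \<and>
      a \<le> (\<Sum>i\<in>{N..<2 * N}. of_bool (Q (s i) x))"
    and growth: "\<And>z. (\<And>i. i < 2 * N \<Longrightarrow> z i \<in> space M) \<Longrightarrow>
      card ((\<lambda>x. {i \<in> {..<2 * N}. Q (z i) x}) ` X) \<le> G"
  shows "measure (PiM {..<2 * N} (\<lambda>_. M)) C \<le> real G * 2 powr (- a)"
proof -
  interpret P: product_prob_space "\<lambda>_. M" "{..<2 * N} :: nat set" ..
  let ?P = "PiM {..<2 * N} (\<lambda>_. M)"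
  define \<tau> where "\<tau> U = (\<lambda>z::nat \<Rightarrow> 'a. \<lambda>i\<in>{..<2 * N}. z (swap_halves N U i))" for U
  have \<tau>_meas[measurable]: "\<tau> U \<in> ?P \<rightarrow>\<^sub>M ?P" for U
    unfolding \<tau>_def by (intro measurable_restrict measurable_component_singleton) (auto intro: swap_halves_less)
  \<comment> \<open>Permuting the coordinates of an IID sample does not change its law.\<close>
  have \<tau>_distr: "distr ?P ?P (\<tau> U) = ?P" if "U \<subseteq> {..<N}" for U
    using distr_PiM_reindex[of "{..<2 * N}" "\<lambda>_. M" "swap_halves N U" "{..<2 * N}"]
      inj_on_subset[OF inj_swap_halves[OF that]] prob_space_axioms
    by (simp add: \<tau>_def swap_halves_less Pi_iff)
  have count: "(\<Sum>U\<in>Pow {..<N}. indicator C (\<tau> U z)) \<le> real G * (2 ^ N * 2 powr (- a))"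
    if z: "z \<in> space ?P" for z
  proof -
    let ?pat = "(\<lambda>x. {i \<in> {..<2 * N}. Q (z i) x}) ` X"
    let ?B = "\<lambda>Z. {U. U \<subseteq> {..<N} \<and> (\<forall>i<N. swap_halves N U i \<notin> Z) \<and>
        a \<le> real (card {i \<in> {N..<2 * N}. swap_halves N U i \<in> Z})}"
    have fin: "finite ?pat" by (rule finite_subset[of _ "Pow {..<2 * N}"]) auto
    have finB: "finite (?B Z)" for Z by (rule finite_subset[of _ "Pow {..<N}"]) auto
    \<comment> \<open>Each swap \<open>U\<close> is charged to the pattern \<open>Z\<close> that its
      witness \<open>x\<close> cuts out of the unswapped sample \<open>z\<close>; position
      \<open>i\<close> of the swapped sample is violated iff
      \<open>swap_halves N U i \<in> Z\<close>. Only the number of patterns matters, although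
      \<open>x\<close> varies with \<open>U\<close>.\<close>
    have "{U \<in> Pow {..<N}. \<tau> U z \<in> C} \<subseteq> (\<Union>Z\<in>?pat. ?B Z)"
    proof
      fix U assume U: "U \<in> {U \<in> Pow {..<N}. \<tau> U z \<in> C}"
      then obtain x where x: "x \<in> X" "\<And>i. i < N \<Longrightarrow> \<not> Q (\<tau> U z i) x"
          "a \<le> (\<Sum>i\<in>{N..<2 * N}. of_bool (Q (\<tau> U z i) x))"
        using C_witness[of "\<tau> U z"] by blast
      let ?Z = "{i \<in> {..<2 * N}. Q (z i) x}"
      have Z: "swap_halves N U i \<in> ?Z \<longleftrightarrow> Q (\<tau> U z i) x" if "i < 2 * N" for i
        using that by (simp add: \<tau>_def swap_halves_less)
      have "{i \<in> {N..<2 * N}. swap_halves N U i \<in> ?Z} = {i \<in> {N..<2 * N}. Q (\<tau> U z i) x}"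
        using Z by auto
      moreover have "(\<Sum>i\<in>{N..<2 * N}. of_bool (Q (\<tau> U z i) x))
          = real (card {i \<in> {N..<2 * N}. Q (\<tau> U z i) x})"
        by (simp add: Int_def)
      ultimately have "a \<le> real (card {i \<in> {N..<2 * N}. swap_halves N U i \<in> ?Z})"
        using x(3) by simp
      moreover have "\<forall>i<N. swap_halves N U i \<notin> ?Z"
        using x(2) Z by auto
      ultimately have "U \<in> ?B ?Z" using U by simp
      then show "U \<in> (\<Union>Z\<in>?pat. ?B Z)" using x(1) by blast
    qed
    then have "card {U \<in> Pow {..<N}. \<tau> U z \<in> C} \<le> card (\<Union>Z\<in>?pat. ?B Z)"
      by (intro card_mono finite_UN_I[OF fin] finB)
    also have "\<dots> \<le> (\<Sum>Z\<in>?pat. card (?B Z))"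
      by (rule card_UN_le[OF fin])
    finally have "real (card {U \<in> Pow {..<N}. \<tau> U z \<in> C}) \<le> (\<Sum>Z\<in>?pat. real (card (?B Z)))"
      by (simp flip: of_nat_sum)
    also have "\<dots> \<le> (\<Sum>Z\<in>?pat. 2 ^ N * 2 powr (- a))"
      by (rule sum_mono, rule card_swaps_le) auto
    also have "\<dots> = real (card ?pat) * (2 ^ N * 2 powr (- a))"
      by simp
    also have "\<dots> \<le> real G * (2 ^ N * 2 powr (- a))"
      using growth[of z] z by (intro mult_right_mono) (auto simp: space_PiM PiE_iff)
    finally show ?thesis by (simp add: indicator_def Int_def)
  qed
  have int: "integrable ?P (\<lambda>z. indicator C (\<tau> U z) :: real)" for U
    using C by (intro P.integrable_const_bound[of _ 1]) (auto intro!: measurable_compose[OF \<tau>_meas])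
  have "2 ^ N * measure ?P C = (\<Sum>U\<in>Pow {..<N}. measure ?P C)"
    by (simp add: card_Pow)
  also have "\<dots> = (\<Sum>U\<in>Pow {..<N}. \<integral>z. indicator C (\<tau> U z) \<partial>?P)"
  proof (rule sum.cong[OF refl])
    fix U assume U: "U \<in> Pow {..<N}"
    have "measure ?P C = (\<integral>z. indicator C z \<partial>distr ?P ?P (\<tau> U))"
      using U C by (simp add: \<tau>_distr)
    also have "\<dots> = (\<integral>z. indicator C (\<tau> U z) \<partial>?P)"
      using C by (intro integral_distr) auto
    finally show "measure ?P C = (\<integral>z. indicator C (\<tau> U z) \<partial>?P)" .
  qed
  also have "\<dots> = (\<integral>z. (\<Sum>U\<in>Pow {..<N}. indicator C (\<tau> U z)) \<partial>?P)"
    using int by (rule Bochner_Integration.integral_sum[symmetric])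
  also have "\<dots> \<le> (\<integral>z. real G * (2 ^ N * 2 powr (- a)) \<partial>?P)"
    using count by (intro integral_mono Bochner_Integration.integrable_sum[OF int]) auto
  also have "\<dots> = 2 ^ N * (real G * 2 powr (- a))"
    by (simp add: P.P.prob_space)
  finally show ?thesis by simp
qed

text \<open>Combines the two previous results with \<open>a = N * \<epsilon> / 2\<close>.
  Consistency is asked almost surely only, because an exceptional null set of samples may leave no
  consistent point.\<close>

theorem (in prob_space) consistent_selector_violation_bound:
  fixes \<epsilon> :: real and S :: "'x measure"
  assumes Q[measurable]: "Measurable.pred (M \<Otimes>\<^sub>M S) (\<lambda>(z, x). Q z x)"
    and sel[measurable]: "xs \<in> PiM {..<N} (\<lambda>_. M) \<rightarrow>\<^sub>M S"
    and cons: "AE s in PiM {..<N} (\<lambda>_. M). \<forall>i<N. \<not> Q (s i) (xs s)"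
    and large: "5 \<le> real N * \<epsilon>"
    and growth: "\<And>z. (\<And>i. i < 2 * N \<Longrightarrow> z i \<in> space M) \<Longrightarrow>
      card ((\<lambda>x. {i \<in> {..<2 * N}. Q (z i) x}) ` space S) \<le> G"
  shows "measure (PiM {..<N} (\<lambda>_. M))
      {s \<in> space (PiM {..<N} (\<lambda>_. M)). \<epsilon> < prob {z \<in> space M. Q z (xs s)}}
    \<le> 2 * real G * 2 powr (- (real N * \<epsilon> / 2))"
proof -
  let ?P1 = "PiM {..<N} (\<lambda>_. M)"
  let ?E = "{s \<in> space ?P1. \<epsilon> < prob {z \<in> space M. Q z (xs s)}}"
  let ?A = "{s \<in> space ?P1. \<epsilon> < prob {z \<in> space M. Q z (xs s)} \<and> (\<forall>i<N. \<not> Q (s i) (xs s))}"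
  have Q_i[measurable]: "Measurable.pred ?P1 (\<lambda>s. Q (s i) (xs s))" if "i < N" for i
  proof -
    have "(\<lambda>s. (s i, xs s)) \<in> ?P1 \<rightarrow>\<^sub>M M \<Otimes>\<^sub>M S"
      using that sel by (intro measurable_Pair measurable_component_singleton) auto
    from measurable_compose[OF this Q] show ?thesis by simp
  qed
  have "Measurable.pred ?P1 (\<lambda>s. \<forall>i\<in>{..<N}. \<not> Q (s i) (xs s))"
    by (intro pred_intros_finite pred_intros_logic Q_i) auto
  then have [measurable]: "Measurable.pred ?P1 (\<lambda>s. \<forall>i<N. \<not> Q (s i) (xs s))"
    by (simp add: Ball_def)
  show ?thesis
  proof (cases "?E \<in> sets ?P1")
    case False
    \<comment> \<open>\<open>measure\<close> is 0 on non-measurable sets, so the bound is trivial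
      here.\<close>
    then show ?thesis by (subst measure_notin_sets) auto
  next
    case True
    have A: "?A \<in> sets ?P1"
    proof -
      have "?A = ?E \<inter> {s \<in> space ?P1. \<forall>i<N. \<not> Q (s i) (xs s)}" by auto
      also have "\<dots> \<in> sets ?P1" using True by (intro sets.Int) measurable
      finally show ?thesis .
    qed
    define C where "C = {s \<in> space (PiM {..<2 * N} (\<lambda>_. M)).
      (\<forall>i<N. \<not> Q (s i) (xs (restrict s {..<N}))) \<and>
      real N * \<epsilon> / 2 \<le> (\<Sum>i\<in>{N..<2 * N}. of_bool (Q (s i) (xs (restrict s {..<N}))))}"
    have "measure ?P1 ?E = measure ?P1 ?A"
      using True A cons by (intro measure_eq_AE) auto
    also have "\<dots> \<le> 2 * measure (PiM {..<2 * N} (\<lambda>_. M)) C"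
      unfolding C_def by (rule double_sampling(2)[OF Q sel large A])
    also have "measure (PiM {..<2 * N} (\<lambda>_. M)) C \<le> real G * 2 powr (- (real N * \<epsilon> / 2))"
    proof (rule swap_bound[where Q = Q and X = "space S"])
      show "C \<in> sets (PiM {..<2 * N} (\<lambda>_. M))"
        unfolding C_def by (rule double_sampling(1)[OF Q sel large A])
      fix s assume s: "s \<in> C"
      then have "restrict s {..<N} \<in> space ?P1"
        by (auto simp: C_def space_PiM PiE_iff)
      then have "xs (restrict s {..<N}) \<in> space S" using sel by (rule measurable_space[rotated])
      with s show "\<exists>x\<in>space S. (\<forall>i<N. \<not> Q (s i) x) \<and>
          real N * \<epsilon> / 2 \<le> (\<Sum>i\<in>{N..<2 * N}. of_bool (Q (s i) x))"
        unfolding C_def by blast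
    qed (rule growth)
    finally show ?thesis by simp
  qed
qed

section \<open>Infeasibility of the second stage\<close>

text \<open>The cone \<open>K\<close> generated by the finitely many columns is closed and misses
  \<open>b\<close>, so a hyperplane separates them strictly. As \<open>0 \<in> K\<close>, the level
  \<open>\<beta>\<close> is negative, and as \<open>K\<close> is a cone, the normal \<open>a\<close>
  must be nonnegative on it.\<close>

lemma farkas:
  fixes A :: "real^'p^'m"
  assumes infeasible: "\<nexists>y. A *v y = b \<and> 0 \<le> y"
  obtains a where "a \<in> dual_cone_of A" "a \<bullet> b < 0"
proof -
  define K where "K = convex_cone hull (columns A)"
  have conv: "convex_cone ((*v) A ` {y. 0 \<le> y})"
    by (intro convex_cone_linear_image)
      (auto simp: convex_cone_iff less_eq_vec_def intro: add_nonneg_nonneg)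
  have col: "column j A \<in> (*v) A ` {y. 0 \<le> y}" for j
    by (rule image_eqI[of _ _ "axis j 1"]) (simp_all add: less_eq_vec_def matrix_vector_mult_basis, simp add: axis_def)
  have "K \<subseteq> (*v) A ` {y. 0 \<le> y}"
    unfolding K_def using col conv by (intro hull_minimal) (auto simp: columns_def)
  then have bK: "b \<notin> K" using infeasible by auto
  have K: "convex_cone K" unfolding K_def by (rule convex_cone_convex_cone_hull)
  have "closed K" unfolding K_def columns_def by (intro closed_convex_cone_hull) (simp add: full_SetCompr_eq)
  then obtain a \<beta> where a: "a \<bullet> b < \<beta>" "\<And>x. x \<in> K \<Longrightarrow> \<beta> < a \<bullet> x"
    using separating_hyperplane_closed_point[of K b] K bK by (auto simp: convex_cone_def)
  have \<beta>: "\<beta> < 0" using a(2)[OF convex_cone_contains_0[OF K]] by simp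
  have "0 \<le> a \<bullet> x" if x: "x \<in> K" for x
  proof (rule ccontr)
    assume "\<not> 0 \<le> a \<bullet> x"
    then have neg: "a \<bullet> x < 0" by simp
    \<comment> \<open>This multiple of \<open>x\<close> lies exactly on the level
      \<open>\<beta>\<close>, contradicting strict separation.\<close>
    with \<beta> have "(\<beta> / (a \<bullet> x)) *\<^sub>R x \<in> K"
      by (intro convex_cone_scaleR[OF K _ x]) (simp add: divide_nonpos_neg)
    from a(2)[OF this] neg show False by simp
  qed
  moreover have "column j A \<in> K" for j
    unfolding K_def by (rule hull_inc) (auto simp: columns_def)
  ultimately have "0 \<le> a \<bullet> column j A" for j by blast
  then have "0 \<le> (a v* A) $ j" for j
    by (simp add: vector_matrix_mult_def inner_vec_def column_def mult.commute)
  with a(1) \<beta> show thesis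
    by (intro that[of a]) (auto simp: dual_cone_of_def less_eq_vec_def)
qed

lemma lin_indep_rows_vector_matrix_mult_eq_0:
  assumes "lin_indep_rows A" "a v* A = 0"
  shows "a = 0"
proof -
  have "(\<Sum>i\<in>UNIV. (a $ i) *\<^sub>R row i A) = 0"
    using assms(2) by (simp add: vec_eq_iff vector_matrix_mult_def row_def mult.commute)
  with assms(1) show ?thesis by (auto simp: lin_indep_rows_def vec_eq_iff)
qed

text \<open>The witness is an extreme point of the base \<open>{a \<in> dual_cone_of A. \<Sum>j. (a v* A) $ j = 1}\<close>,
  which is compact because the rows are independent; Krein--Milman applies to it.\<close>

lemma extreme_direction_separates:
  fixes A :: "real^'p^'m"
  assumes indep: "lin_indep_rows A" and a: "a \<in> dual_cone_of A" "a \<bullet> b < 0"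
  obtains e where "e \<in> extreme_directions (dual_cone_of A)" "e \<bullet> b < 0"
proof -
  let ?C = "dual_cone_of A"
  \<comment> \<open>A linear functional that is positive on the nonzero vectors of the cone, so its
    level set 1 is a base.\<close>
  define l where "l a = (\<Sum>j\<in>UNIV. (a v* A) $ j)" for a
  define S where "S = {a \<in> ?C. l a = 1}"
  have lin: "linear (\<lambda>a. a v* A)"
    by (intro linearI) (simp_all add: vector_matrix_left_distrib scaleR_vector_matrix_assoc)
  have l_add: "l (u + v) = l u + l v" for u v
    by (simp add: l_def linear_add[OF lin] sum.distrib)
  have l_scale: "l (c *\<^sub>R u) = c * l u" for c u
    by (simp add: l_def linear_cmul[OF lin] sum_distrib_left)
  have C_add: "u + v \<in> ?C" if "u \<in> ?C" "v \<in> ?C" for u v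
    using that by (simp add: dual_cone_of_def linear_add[OF lin] add_nonneg_nonneg)
  have C_scale: "c *\<^sub>R u \<in> ?C" if "0 \<le> c" "u \<in> ?C" for c u
    using that by (simp add: dual_cone_of_def linear_cmul[OF lin] less_eq_vec_def)
  have l_nonneg: "0 \<le> l u" if "u \<in> ?C" for u
    using that by (auto simp: l_def dual_cone_of_def less_eq_vec_def intro: sum_nonneg)
  have l_pos: "0 < l u" if "u \<in> ?C" "u \<noteq> 0" for u
  proof -
    have "l u \<noteq> 0"
    proof
      assume "l u = 0"
      then have "\<forall>j. (u v* A) $ j = 0"
        using that(1) by (simp add: l_def dual_cone_of_def less_eq_vec_def sum_nonneg_eq_0_iff)
      then have "u v* A = 0" by (simp add: vec_eq_iff)
      with indep that(2) show False using lin_indep_rows_vector_matrix_mult_eq_0 by blast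
    qed
    with l_nonneg[OF that(1)] show ?thesis by simp
  qed
  have "convex S"
    unfolding S_def by (intro convexI) (auto simp: l_add l_scale intro: C_add C_scale)
  have "compact S"
  proof -
    have "continuous_on UNIV (\<lambda>a. a v* A)" by (rule linear_continuous_on[OF linear_conv_bounded_linear[THEN iffD1, OF lin]])
    then have cont: "continuous_on UNIV (\<lambda>a. (a v* A) $ j)" for j
      by (intro continuous_intros)
    have "S = (\<Inter>j. {a. 0 \<le> (a v* A) $ j}) \<inter> {a. l a = 1}"
      by (auto simp: S_def dual_cone_of_def less_eq_vec_def)
    moreover have "closed \<dots>"
      unfolding l_def by (intro closed_Int closed_INT ballI closed_Collect_le closed_Collect_eq
        continuous_intros cont)
    ultimately have "closed S" by simp
    \<comment> \<open>On the cone \<open>l a\<close> is the l1 norm of \<open>a v* A\<close>, hence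
      1 on \<open>S\<close>; an injective linear map is bounded below, so \<open>S\<close> is
      bounded.\<close>
    have "inj (\<lambda>a. a v* A)"
      using lin_indep_rows_vector_matrix_mult_eq_0[OF indep] by (simp add: linear_injective_0[OF lin])
    then obtain B where B: "B > 0" "\<And>a. B * norm a \<le> norm (a v* A)"
      using linear_inj_bounded_below_pos[OF lin] by (metis mult.commute)
    have "norm a \<le> 1 / B" if "a \<in> S" for a
    proof -
      have "norm (a v* A) \<le> (\<Sum>j\<in>UNIV. \<bar>(a v* A) $ j\<bar>)" by (rule norm_le_l1_cart)
      also have "\<dots> = 1"
        using that by (simp add: S_def l_def dual_cone_of_def less_eq_vec_def)
      finally have "B * norm a \<le> 1" using B(2)[of a] by simp
      with B(1) show ?thesis by (simp add: field_simps)
    qed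
    then have "bounded S" by (auto simp: bounded_iff)
    with \<open>closed S\<close> show ?thesis by (simp add: compact_eq_bounded_closed)
  qed
  have "\<exists>e. e extreme_point_of S \<and> e \<bullet> b < 0"
  proof (rule ccontr)
    assume "\<nexists>e. e extreme_point_of S \<and> e \<bullet> b < 0"
    then have "{e. e extreme_point_of S} \<subseteq> {e. b \<bullet> e \<ge> 0}"
      by (auto simp: inner_commute not_less)
    then have "convex hull {e. e extreme_point_of S} \<subseteq> {e. b \<bullet> e \<ge> 0}"
      by (rule hull_minimal) (rule convex_halfspace_ge)
    then have S_nonneg: "S \<subseteq> {e. b \<bullet> e \<ge> 0}"
      using Krein_Milman_Minkowski[OF \<open>compact S\<close> \<open>convex S\<close>] by simp
    have "a \<noteq> 0" using a(2) by auto
    then have la: "0 < l a" using l_pos a(1) by blast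
    then have "(1 / l a) *\<^sub>R a \<in> S"
      using a(1) by (simp add: S_def l_scale C_scale)
    with S_nonneg have "0 \<le> (1 / l a) * (b \<bullet> a)" by auto
    with la a(2) show False by (simp add: inner_commute zero_le_divide_iff)
  qed
  then obtain e where e: "e extreme_point_of S" "e \<bullet> b < 0" by blast
  then have eS: "e \<in> ?C" "l e = 1" by (auto simp: extreme_point_of_def S_def)
  have "\<exists>s\<ge>0. \<exists>t\<ge>0. u = s *\<^sub>R e \<and> v = t *\<^sub>R e" if uv: "u \<in> ?C" "v \<in> ?C" "e = u + v" for u v
  proof (cases "u = 0 \<or> v = 0")
    case True
    then show ?thesis
    proof
      assume "u = 0"
      with uv(3) show ?thesis by (intro exI[of _ 0] conjI exI[of _ 1]) auto
    next
      assume "v = 0"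
      with uv(3) show ?thesis by (intro exI[of _ 1] conjI exI[of _ 0]) auto
    qed
  next
    case False
    then have pos: "0 < l u" "0 < l v" using uv l_pos by auto
    have sum1: "l u + l v = 1" using eS(2) uv(3) by (simp add: l_add)
    \<comment> \<open>Rescaled to the base, \<open>u\<close> and \<open>v\<close> express
      \<open>e\<close> as a convex combination with weights \<open>l u\<close> and
      \<open>l v\<close>; extremality of \<open>e\<close> forces both rescaled points to equal
      \<open>e\<close>.\<close>
    let ?u = "(1 / l u) *\<^sub>R u" and ?v = "(1 / l v) *\<^sub>R v"
    have S: "?u \<in> S" "?v \<in> S" using uv pos by (auto simp: S_def l_scale C_scale)
    have e_comb: "e = (1 - l v) *\<^sub>R ?u + l v *\<^sub>R ?v"
    proof -
      have "1 - l v = l u" using sum1 by simp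
      then show ?thesis using uv(3) pos by simp
    qed
    have "?u = ?v"
    proof (rule ccontr)
      assume "?u \<noteq> ?v"
      then have "e \<in> open_segment ?u ?v"
        using e_comb pos sum1 unfolding in_segment by (intro conjI exI[of _ "l v"]) auto
      with e(1) S show False by (simp add: extreme_point_of_def)
    qed
    then have "e = ?u"
      using e_comb[folded \<open>?u = ?v\<close>] unfolding scaleR_left_distrib[symmetric] by simp
    moreover from this have "e = ?v" using \<open>?u = ?v\<close> by (rule trans)
    ultimately have "u = l u *\<^sub>R e" "v = l v *\<^sub>R e"
      using pos by (metis divide_self_if less_irrefl scaleR_one scaleR_scaleR times_divide_eq_right mult.right_neutral)+
    with pos show ?thesis by (metis less_imp_le)
  qed
  then have "e \<in> extreme_directions ?C"
    using eS e(2) by (auto simp: extreme_directions_def)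
  with e(2) show thesis by (rule that[rotated])
qed

text \<open>Forward: Farkas followed by the passage to an extreme direction. Backward: for feasible
  \<open>y\<close>, \<open>a \<bullet> b\<close> equals \<open>(a v* A) \<bullet> y\<close>, which
  is nonnegative. An arbitrary representative will do because the sign of
  \<open>a \<bullet> b\<close> is constant along a ray.\<close>

lemma infeasible_iff_extreme_ray:
  fixes A :: "real^'p^'m"
  assumes indep: "lin_indep_rows A"
  shows "(\<nexists>y. A *v y = b \<and> 0 \<le> y) \<longleftrightarrow>
    (\<exists>R \<in> extreme_rays (dual_cone_of A). (SOME a. a \<in> R) \<bullet> b < 0)"
    (is "?L \<longleftrightarrow> ?R")
proof
  let ?D = "extreme_directions (dual_cone_of A)"
  have some: "\<exists>t>0. (SOME a. a \<in> ray_equiv ?D `` {e}) = t *\<^sub>R e \<and> t *\<^sub>R e \<in> ?D" if "e \<in> ?D" for e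
  proof -
    have "e \<in> ray_equiv ?D `` {e}" using that by (auto simp: ray_equiv_def intro: exI[of _ 1])
    then have "(SOME a. a \<in> ray_equiv ?D `` {e}) \<in> ray_equiv ?D `` {e}" by (rule someI)
    then show ?thesis by (auto simp: ray_equiv_def)
  qed
  show ?R if infeasible: ?L
  proof -
    obtain a where "a \<in> dual_cone_of A" "a \<bullet> b < 0" using farkas[OF infeasible] by blast
    then obtain e where e: "e \<in> ?D" "e \<bullet> b < 0"
      using extreme_direction_separates[OF indep] by blast
    then have "(SOME a. a \<in> ray_equiv ?D `` {e}) \<bullet> b < 0"
      using some[OF e(1)] by (auto simp: mult_pos_neg)
    with e(1) show ?R unfolding extreme_rays_def by (blast intro: quotientI)
  qed
  show ?L if ?R
  proof
    from that obtain e where e: "e \<in> ?D" "(SOME a. a \<in> ray_equiv ?D `` {e}) \<bullet> b < 0"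
      by (auto simp: extreme_rays_def elim: quotientE)
    with some[OF e(1)] obtain a where a: "a \<in> dual_cone_of A" "a \<bullet> b < 0"
      by (auto simp: extreme_directions_def)
    assume "\<exists>y. A *v y = b \<and> 0 \<le> y"
    then obtain y where y: "b = A *v y" "0 \<le> y" by blast
    have "a \<bullet> b = (a v* A) \<bullet> y" using y(1) by (simp add: dot_lmul_matrix)
    also have "\<dots> \<ge> 0"
      using a(1) y(2) by (auto simp: dual_cone_of_def less_eq_vec_def inner_vec_def intro!: sum_nonneg)
    finally show False using a(2) by simp
  qed
qed

section \<open>Counting infeasibility patterns\<close>

text \<open>The ground set \<open>I\<close> consists of pairs (scenario, ray). The condition
  \<open>a \<bullet> (h i - T i *v x) < 0\<close> is an open half-space in \<open>x\<close> with
  normal \<open>a v* T i\<close>. A scenario is infeasible iff one of its pairs is hit, so the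
  scenario pattern is the image under \<open>fst\<close> of the half-space pattern, and taking
  images cannot increase their number.\<close>

lemma card_infeasible_patterns_le:
  fixes W :: "nat \<Rightarrow> real^'p^'m" and T :: "nat \<Rightarrow> real^'n^'m" and h :: "nat \<Rightarrow> real^'m"
  assumes indep: "\<And>i. i < m \<Longrightarrow> lin_indep_rows (W i)"
    and fin: "\<And>i. i < m \<Longrightarrow> finite (extreme_rays (dual_cone_of (W i)))"
    and k: "\<And>i. i < m \<Longrightarrow> card (extreme_rays (dual_cone_of (W i))) \<le> k"
  shows "card ((\<lambda>x. {i \<in> {..<m}. \<nexists>y. W i *v y + T i *v x = h i \<and> 0 \<le> y}) ` X)
    \<le> (\<Sum>j\<le>CARD('n). (m * k) choose j)"
proof -
  define I where "I = Sigma {..<m} (\<lambda>i. extreme_rays (dual_cone_of (W i)))"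
  define r where "r = (\<lambda>p :: nat \<times> (real^'m) set. SOME a. a \<in> snd p)"
  define c where "c = (\<lambda>p. r p v* T (fst p))"
  define b where "b = (\<lambda>p. r p \<bullet> h (fst p))"
  let ?pat = "\<lambda>x. {p \<in> I. b p < c p \<bullet> x}"
  have I: "finite I" unfolding I_def using fin by auto
  have "card I = (\<Sum>i<m. card (extreme_rays (dual_cone_of (W i))))"
    unfolding I_def using fin by (intro card_SigmaI) auto
  also have "\<dots> \<le> (\<Sum>i<m. k)" using k by (intro sum_mono) auto
  finally have card_I: "card I \<le> m * k" by simp
  have "{i \<in> {..<m}. \<nexists>y. W i *v y + T i *v x = h i \<and> 0 \<le> y} = fst ` ?pat x" for x
  proof -
    have "(\<nexists>y. W i *v y + T i *v x = h i \<and> 0 \<le> y) \<longleftrightarrow> (\<exists>R. (i, R) \<in> ?pat x)" if "i < m" for i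
    proof -
      have "(\<nexists>y. W i *v y + T i *v x = h i \<and> 0 \<le> y) \<longleftrightarrow> (\<nexists>y. W i *v y = h i - T i *v x \<and> 0 \<le> y)"
        by (simp add: eq_diff_eq)
      also have "\<dots> \<longleftrightarrow> (\<exists>R \<in> extreme_rays (dual_cone_of (W i)). (SOME a. a \<in> R) \<bullet> (h i - T i *v x) < 0)"
        by (rule infeasible_iff_extreme_ray[OF indep[OF that]])
      also have "\<dots> \<longleftrightarrow> (\<exists>R. (i, R) \<in> ?pat x)"
        using that by (auto simp: I_def r_def b_def c_def inner_diff_right dot_lmul_matrix)
      finally show ?thesis .
    qed
    moreover have "i < m" if "(i, R) \<in> ?pat x" for i R
      using that by (auto simp: I_def)
    ultimately show ?thesis by force
  qed
  then have "(\<lambda>x. {i \<in> {..<m}. \<nexists>y. W i *v y + T i *v x = h i \<and> 0 \<le> y}) ` X = (`) fst ` ?pat ` X"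
    by (simp add: image_image)
  also have "card \<dots> \<le> card (?pat ` X)"
    by (intro card_image_le finite_subset[of "?pat ` X" "Pow I"]) (use I in auto)
  also have "\<dots> \<le> (\<Sum>j\<le>DIM(real^'n). card I choose j)"
    by (rule card_halfspace_patterns_le[OF I])
  also have "\<dots> \<le> (\<Sum>j\<le>CARD('n). (m * k) choose j)"
    using card_I by (auto intro: sum_mono binomial_right_mono)
  finally show ?thesis .
qed

section \<open>Measurability of second-stage infeasibility\<close>

lemma continuous_on_matrix_vector_mult [continuous_intros]:
  fixes A :: "'a::topological_space \<Rightarrow> real^'p^'m" and y :: "'a \<Rightarrow> real^'p"
  assumes "continuous_on S A" "continuous_on S y"
  shows "continuous_on S (\<lambda>x. A x *v y x)"
  unfolding matrix_vector_mult_def using assms by (intro continuous_intros)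

lemma borel_measurable_matrix_vector_mult [measurable (raw)]:
  fixes A :: "'a \<Rightarrow> real^'p^'m" and y :: "'a \<Rightarrow> real^'p"
  assumes "A \<in> borel_measurable M" "y \<in> borel_measurable M"
  shows "(\<lambda>x. A x *v y x) \<in> borel_measurable M"
  using assms by (rule borel_measurable_continuous_Pair) (intro continuous_intros)

text \<open>A projection of a closed set along a compact factor is closed. Truncating
  \<open>y\<close> to balls of integer radius therefore exhibits the set as a countable union of
  closed sets.\<close>

lemma borel_feasible_right_hand_sides:
  "{(A :: real^'p^'m, b). \<exists>y. A *v y = b \<and> 0 \<le> y} \<in> sets borel"
proof -
  let ?K = "\<lambda>k::nat. {y :: real^'p. 0 \<le> y} \<inter> cball 0 k"
  let ?E = "{q :: (real^'p) \<times> (real^'p^'m) \<times> (real^'m). fst (snd q) *v fst q = snd (snd q)}"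
  have "{y :: real^'p. 0 \<le> y} = (\<Inter>i. {y. 0 \<le> y $ i})"
    by (auto simp: less_eq_vec_def)
  also have "closed \<dots>"
    by (intro closed_INT ballI closed_Collect_le continuous_intros)
  finally have "compact (?K k)" for k
    by (intro closed_Int_compact compact_cball)
  moreover have "closed ?E"
    by (intro closed_Collect_eq continuous_intros)
  ultimately have "closed {p. \<exists>y. y \<in> ?K k \<and> (y, p) \<in> ?E}" for k
    by (rule closed_compact_projection)
  then have "(\<Union>k. {p. \<exists>y. y \<in> ?K k \<and> (y, p) \<in> ?E}) \<in> sets borel"
    by (intro sets.countable_UN') auto
  also have "(\<Union>k. {p. \<exists>y. y \<in> ?K k \<and> (y, p) \<in> ?E}) = {(A, b). \<exists>y. A *v y = b \<and> 0 \<le> y}"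
    (is "?U = ?V")
  proof
    show "?V \<subseteq> ?U"
    proof (clarify)
      fix A :: "real^'p^'m" and y :: "real^'p"
      assume "0 \<le> y"
      moreover obtain k :: nat where "norm y \<le> real k" using real_arch_simple by blast
      ultimately have "y \<in> ?K k" by simp
      then show "(A, A *v y) \<in> ?U" by auto
    qed
  qed auto
  finally show ?thesis .
qed

lemma measurable_infeasible:
  fixes A :: "'a \<Rightarrow> real^'p^'m" and B :: "'a \<Rightarrow> real^'n^'m"
  assumes [measurable]: "A \<in> borel_measurable M" "B \<in> borel_measurable M"
    "b \<in> borel_measurable M" "x \<in> borel_measurable M"
  shows "Measurable.pred M (\<lambda>z. \<nexists>y. A z *v y + B z *v x z = b z \<and> 0 \<le> y)"
proof -
  have "(\<lambda>z. (A z, b z - B z *v x z)) \<in> borel_measurable M"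
    by measurable
  from measurable_sets[OF this borel_feasible_right_hand_sides]
  have "{z \<in> space M. \<exists>y. A z *v y = b z - B z *v x z \<and> 0 \<le> y} \<in> sets M"
    by (simp add: vimage_def Int_def conj_commute)
  then have "Measurable.pred M (\<lambda>z. \<exists>y. A z *v y = b z - B z *v x z \<and> 0 \<le> y)"
    by (simp add: pred_def)
  then show ?thesis
    unfolding eq_diff_eq by (rule pred_intros_logic(2))
qed

section \<open>Numerical estimates\<close>

text \<open>The constant factor of \<open>d_VC\<close> is at least 2, by
  \<open>ln 2 \<le> 25 / 36\<close> and the bound 3 on \<open>exp 1\<close>; its logarithm is at
  least 1 because \<open>k / ln 2 \<ge> 1\<close>.\<close>

lemma d_VC_lower_bound:
  assumes "1 \<le> k"
  shows "2 * real k * (real n + 1) \<le> d_VC k n"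
proof -
  have e: "2 \<le> exp (1::real)" "exp (1::real) \<le> 3"
    using exp_ge_add_one_self[of 1] exp_le by simp_all
  have l: "0 < ln (2::real)" "ln (2::real) \<le> 25 / 36" using ln2_le_25_over_36 by simp_all
  have "2 * ((exp 1 - 1) * ln 2) \<le> 2 * ((exp 1 - 1) * (25 / 36 :: real))"
    using e l by (intro mult_left_mono) auto
  also have "\<dots> \<le> exp 1" using e by simp
  finally have "2 \<le> exp 1 / ((exp 1 - 1) * ln 2 :: real)"
    using e l by (simp add: field_simps)
  moreover have "1 \<le> ln (exp 1 / ln 2 * real k)"
  proof -
    have "exp 1 * 1 \<le> exp 1 * (real k / ln 2)"
      using assms l by (intro mult_left_mono) (auto simp: field_simps)
    then show ?thesis using l assms by (subst ln_ge_iff) (auto simp: field_simps)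
  qed
  ultimately have "2 * (real k * (real n + 1)) * 1
      \<le> exp 1 / ((exp 1 - 1) * ln 2) * (real k * (real n + 1)) * ln (exp 1 / ln 2 * real k)"
    by (intro mult_mono) auto
  then show ?thesis by (simp add: d_VC_def mult.assoc)
qed

text \<open>The partial binomial sum is estimated with \<open>t = \<epsilon> / (24 k)\<close>; the factor \<open>exp (N \<epsilon> / 12)\<close>
  this costs is absorbed by the gap between \<open>ln 2 / 2\<close> and \<open>1 / 4\<close>.\<close>

lemma growth_times_tail_le:
  fixes \<epsilon> :: real
  assumes k: "1 \<le> k" and \<epsilon>: "0 < \<epsilon>" "\<epsilon> < 1"
  shows "real (\<Sum>j\<le>n. (2 * N * k) choose j) * 2 powr (- (real N * \<epsilon> / 2))
    \<le> exp (- (real N * \<epsilon>) / 4) * (12 / \<epsilon>) powr d_VC k n"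
proof -
  define t where "t = \<epsilon> / (24 * real k)"
  have t: "0 < t" "t \<le> 1" using k \<epsilon> by (auto simp: t_def field_simps)
  have "real (\<Sum>j\<le>n. (2 * N * k) choose j) * 2 powr (- (real N * \<epsilon> / 2))
      \<le> exp (t * real (2 * N * k)) / t ^ n * 2 powr (- (real N * \<epsilon> / 2))"
    by (intro mult_right_mono binomial_partial_sum_le[OF t]) auto
  also have "\<dots> = (exp (real N * \<epsilon> / 12) * exp (- (real N * \<epsilon> / 2) * ln 2)) * (1 / t) ^ n"
    using k by (simp add: t_def powr_def power_divide field_simps)
  also have "\<dots> \<le> exp (- (real N * \<epsilon>) / 4) * (12 / \<epsilon>) powr d_VC k n"
  proof (intro mult_mono)
    \<comment> \<open>The choice of \<open>t\<close> leaves the coefficient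
      \<open>1 / 12 - ln 2 / 2\<close> of \<open>N * \<epsilon>\<close>;
      \<open>ln 2 \<ge> 2 / 3\<close> brings it to exactly -1/4.\<close>
    have "2 / 3 \<le> ln (2::real)" by (rule ln2_ge_two_thirds)
    then have "real N * \<epsilon> * (2 / 3) \<le> real N * \<epsilon> * ln 2"
      using \<epsilon> by (intro mult_left_mono) auto
    then show "exp (real N * \<epsilon> / 12) * exp (- (real N * \<epsilon> / 2) * ln 2) \<le> exp (- (real N * \<epsilon>) / 4)"
      by (simp flip: exp_add)
    have base: "1 \<le> 12 / \<epsilon>" using \<epsilon> by simp
    \<comment> \<open>\<open>1 / t\<close> is \<open>2 * k\<close> times
      \<open>12 / \<epsilon>\<close>, and \<open>2 * k \<le> 2 ^ k\<close>; the total exponent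
      \<open>2 * k * n\<close> then fits below \<open>d_VC k n\<close>.\<close>
    have "1 / t \<le> (12 / \<epsilon>) ^ (2 * k)"
    proof -
      have "2 * real k \<le> 2 ^ k * 1"
        using k
      proof (induction k rule: dec_induct)
        case (step j)
        then show ?case using of_nat_mono[of 1 j, where 'a = real] by simp
      qed simp
      also have "\<dots> \<le> 12 ^ k * (12 / \<epsilon>) ^ (k - 1)"
        using base by (intro mult_mono power_mono one_le_power) auto
      finally have "2 * real k * (12 / \<epsilon>) \<le> 12 ^ k * (12 / \<epsilon>) ^ (k - 1) * (12 / \<epsilon>)"
        using \<epsilon> by (intro mult_right_mono) auto
      also have "\<dots> = 12 ^ k * (12 / \<epsilon>) ^ k"
        using power_Suc2[of "12 / \<epsilon>" "k - 1"] k by (simp only: mult.assoc) simp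
      also have "\<dots> \<le> (12 / \<epsilon>) ^ k * (12 / \<epsilon>) ^ k"
        using \<epsilon> by (intro mult_right_mono power_mono) (auto simp: field_simps)
      also have "\<dots> = (12 / \<epsilon>) ^ (2 * k)" by (simp add: mult_2 power_add)
      finally show ?thesis using k by (simp add: t_def field_simps)
    qed
    then have "(1 / t) ^ n \<le> ((12 / \<epsilon>) ^ (2 * k)) ^ n"
      using t by (intro power_mono) auto
    also have "\<dots> = (12 / \<epsilon>) powr (2 * real k * real n)"
      using \<epsilon> by (simp add: powr_realpow[symmetric] powr_powr flip: power_mult)
    also have "\<dots> \<le> (12 / \<epsilon>) powr d_VC k n"
      using d_VC_lower_bound[OF k, of n] base by (intro powr_mono) (auto simp: algebra_simps)
    finally show "(1 / t) ^ n \<le> (12 / \<epsilon>) powr d_VC k n" .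
  qed (use t in auto)
  finally show ?thesis .
qed

section \<open>The bound for the two-stage problem\<close>

theorem corollary4p7:
  fixes M :: "'w measure"
    and \<xi> :: "'w \<Rightarrow> real^'r"
    and \<Xi> :: "(real^'r) set"
    and X :: "(real^'n) set"
    and \<nu> :: "(real^'n) measure"
    and f0 :: "real^'n \<Rightarrow> real"
    and g :: "real^'r \<Rightarrow> real^'p \<Rightarrow> ereal"
    and W :: "real^'r \<Rightarrow> real^'p^'m"
    and T :: "real^'r \<Rightarrow> real^'n^'m"
    and h :: "real^'r \<Rightarrow> real^'m"
    and f :: "real^'r \<Rightarrow> real^'n \<Rightarrow> ereal"
    and N :: nat
    and xstar :: "(nat \<Rightarrow> real^'r) \<Rightarrow> real^'n"
  defines "f \<equiv> recourse g W T h"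
  assumes "prob_space M" and "complete_measure M"
    and "\<xi> \<in> M \<rightarrow>\<^sub>M restrict_space borel \<Xi>"
    and "X \<noteq> {}" and "closed X"
    and W_meas: "W \<in> borel_measurable (restrict_space borel \<Xi>)"
    and T_meas: "T \<in> borel_measurable (restrict_space borel \<Xi>)"
    and h_meas: "h \<in> borel_measurable (restrict_space borel \<Xi>)"
    and g_convex_finite: "AE \<zeta> in law M \<Xi> \<xi>.
          (\<forall>y. \<bar>g \<zeta> y\<bar> \<noteq> \<infinity>) \<and> convex_on UNIV (\<lambda>y. real_of_ereal (g \<zeta> y))"
    and f_proper: "\<And>\<zeta> x. \<zeta> \<in> \<Xi> \<Longrightarrow> x \<in> X \<Longrightarrow> f \<zeta> x \<noteq> -\<infinity>"
    and f_lsc: "\<And>\<zeta>. \<zeta> \<in> \<Xi> \<Longrightarrow> lsc_on X (f \<zeta>)"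
    and nu: "sigma_finite_measure \<nu>" "sets \<nu> = sets (restrict_space borel X)"
    and f_joint_meas:
          "(\<lambda>(\<omega>, x). f (\<xi> \<omega>) x) \<in> borel_measurable (completion (M \<Otimes>\<^sub>M \<nu>))"
    and f_section_meas: "\<And>x. x \<in> X \<Longrightarrow> (\<lambda>\<omega>. f (\<xi> \<omega>) x) \<in> borel_measurable M"
    and finite_objective: "{x \<in> X. objective M \<xi> f0 f x < \<infinity>} \<noteq> {}"
    and W_rows: "\<And>\<zeta>. \<zeta> \<in> \<Xi> \<Longrightarrow> lin_indep_rows (W \<zeta>)"
    and J_fin: "J_finite W \<Xi>"
    and xstar_meas: "xstar \<in> sample_law M \<Xi> \<xi> N \<rightarrow>\<^sub>M restrict_space borel X"
    and xstar_feasible: "\<And>s. s \<in> space (sample_law M \<Xi> \<xi> N) \<Longrightarrow>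
          saa_feasible f X N s \<noteq> {} \<Longrightarrow> xstar s \<in> saa_feasible f X N s"
  shows "\<forall>\<epsilon> \<delta> :: real. 0 < \<epsilon> \<and> \<epsilon> < 1 \<and> 0 < \<delta> \<and> \<delta> < 1 \<longrightarrow>
      (let d = d_VC (J_card W \<Xi>) CARD('n);
           p = measure (sample_law M \<Xi> \<xi> N)
                 {s \<in> space (sample_law M \<Xi> \<xi> N). violation M \<xi> f (xstar s) > \<epsilon>}
       in (real N \<ge> 4 / \<epsilon> * (d * ln (12 / \<epsilon>) + ln (2 / \<delta>)) \<longrightarrow> p \<le> \<delta>) \<and>
          p \<le> 2 * exp (- (real N * \<epsilon>) / 4) * (12 / \<epsilon>) powr d)"
proof -
  interpret M: prob_space M by fact
  note \<xi>[measurable] = \<open>\<xi> \<in> M \<rightarrow>\<^sub>M restrict_space borel \<Xi>\<close>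
  define L where "L = law M \<Xi> \<xi>"
  define S where "S = restrict_space borel X"
  \<comment> \<open>\<open>Q\<close> refers to the constraints only. It agrees with
    \<open>f \<zeta> x = \<infinity>\<close> wherever \<open>g \<zeta>\<close> is finite, thus for
    almost every scenario, simultaneously for all \<open>x\<close>.\<close>
  define Q where "Q = (\<lambda>\<zeta> x. \<nexists>y. W \<zeta> *v y + T \<zeta> *v x = h \<zeta> \<and> 0 \<le> y)"
  define k where "k = J_card W \<Xi>"
  interpret L: prob_space L
    unfolding L_def law_def by (rule M.prob_space_distr) fact
  have sets_L [measurable_cong]: "sets L = sets (restrict_space borel \<Xi>)"
    by (simp add: L_def law_def)
  have space_L: "space L = \<Xi>" using sets_eq_imp_space_eq[OF sets_L] by (simp add: space_restrict_space)
  have space_S: "space S = X" by (simp add: S_def space_restrict_space)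
  have \<xi>_in: "\<xi> \<omega> \<in> \<Xi>" if "\<omega> \<in> space M" for \<omega>
    using measurable_space[OF \<xi> that] by (simp add: space_restrict_space)
  have PL: "sample_law M \<Xi> \<xi> N = PiM {..<N} (\<lambda>_. L)"
    by (simp add: sample_law_def L_def)
  interpret P: product_prob_space "\<lambda>_. L" "{..<N}" ..
  have xs: "xstar \<in> PiM {..<N} (\<lambda>_. L) \<rightarrow>\<^sub>M S"
    using xstar_meas by (simp add: PL S_def)

  have f_Q: "f \<zeta> x = \<infinity>" if "Q \<zeta> x" for \<zeta> x
  proof -
    have "{y. W \<zeta> *v y + T \<zeta> *v x = h \<zeta> \<and> 0 \<le> y} = {}" using that by (simp add: Q_def)
    then show ?thesis unfolding f_def recourse_def by (simp only: image_empty Inf_empty top_ereal_def)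
  qed
  have f_not_Q: "f \<zeta> x < \<infinity>" if nQ: "\<not> Q \<zeta> x" and fin: "\<forall>y. \<bar>g \<zeta> y\<bar> \<noteq> \<infinity>" for \<zeta> x
  proof -
    obtain y where y: "W \<zeta> *v y + T \<zeta> *v x = h \<zeta>" "0 \<le> y" using nQ by (auto simp: Q_def)
    then have "f \<zeta> x \<le> g \<zeta> y" unfolding f_def recourse_def by (intro INF_lower) auto
    also have "\<dots> < \<infinity>" using fin[rule_format, of y] by (cases "g \<zeta> y") auto
    finally show ?thesis .
  qed
  have good: "AE \<zeta> in L. \<forall>y. \<bar>g \<zeta> y\<bar> \<noteq> \<infinity>"
    unfolding L_def using g_convex_finite by (rule AE_mp) (rule AE_I2, rule impI, erule conjunct1)
  have good_\<xi>: "AE \<omega> in M. \<forall>y. \<bar>g (\<xi> \<omega>) y\<bar> \<noteq> \<infinity>"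
    using good unfolding L_def law_def by (rule AE_distrD[OF \<xi>])

  \<comment> \<open>Joint measurability is what allows the data-dependent point
    \<open>xstar s\<close> to be substituted for \<open>x\<close>.\<close>
  have Q_meas: "Measurable.pred (L \<Otimes>\<^sub>M S) (\<lambda>(\<zeta>, x). Q \<zeta> x)"
  proof -
    have id: "(\<lambda>x. x) \<in> borel_measurable S" unfolding S_def by (rule measurable_restrict_space1) simp
    have "W \<in> borel_measurable L" "T \<in> borel_measurable L" "h \<in> borel_measurable L"
      unfolding measurable_cong_sets[OF sets_L refl] by (fact W_meas T_meas h_meas)+
    then have "Measurable.pred (L \<Otimes>\<^sub>M S)
        (\<lambda>p. \<nexists>y. W (fst p) *v y + T (fst p) *v snd p = h (fst p) \<and> 0 \<le> y)"
      by (intro measurable_infeasible measurable_compose[OF measurable_fst]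
        measurable_compose[OF measurable_snd id])
    then show ?thesis by (simp add: Q_def split_beta')
  qed
  have Q_x: "Measurable.pred L (\<lambda>\<zeta>. Q \<zeta> x)" if "x \<in> X" for x
  proof -
    have "x \<in> space S" using that by (simp add: space_S)
    from measurable_compose[OF measurable_Pair2'[OF this] Q_meas] show ?thesis by simp
  qed

  have viol: "violation M \<xi> f x = measure L {\<zeta> \<in> space L. Q \<zeta> x}" if x: "x \<in> X" for x
  proof -
    have Qs: "{\<zeta> \<in> space L. Q \<zeta> x} \<in> sets (restrict_space borel \<Xi>)"
      using Q_x[OF x] by (simp add: pred_def sets_L)
    have eq: "\<xi> -` {\<zeta> \<in> space L. Q \<zeta> x} \<inter> space M = {\<omega> \<in> space M. Q (\<xi> \<omega>) x}"
      using \<xi>_in by (auto simp: space_L)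
    have "{\<omega> \<in> space M. Q (\<xi> \<omega>) x} \<in> sets M"
      using measurable_sets[OF \<xi> Qs] by (simp only: eq)
    moreover have "{\<omega> \<in> space M. f (\<xi> \<omega>) x = \<infinity>} \<in> sets M"
      using f_section_meas[OF x] by measurable
    ultimately have "violation M \<xi> f x = measure M {\<omega> \<in> space M. Q (\<xi> \<omega>) x}"
      unfolding violation_def using good_\<xi> f_Q f_not_Q by (intro measure_eq_AE) (auto elim!: eventually_mono)
    also have "\<dots> = measure L {\<zeta> \<in> space L. Q \<zeta> x}"
      unfolding L_def law_def measure_distr[OF \<xi> Qs[unfolded L_def law_def]]
      by (simp only: eq[unfolded L_def law_def])
    finally show ?thesis .
  qed

  \<comment> \<open>\<open>xstar\<close> is promised to be feasible only when the SAA problem is. A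
    point \<open>x0\<close> of finite objective is feasible for almost every scenario, so the SAA
    problem is feasible for almost every sample.\<close>
  have cons: "AE s in PiM {..<N} (\<lambda>_. L). \<forall>i<N. \<not> Q (s i) (xstar s)"
  proof -
    obtain x0 where x0: "x0 \<in> X" "objective M \<xi> f0 f x0 < \<infinity>" using finite_objective by blast
    have "(\<integral>\<^sup>+\<omega>. e2ennreal (f (\<xi> \<omega>) x0) \<partial>M) \<noteq> \<infinity>"
    proof
      assume "(\<integral>\<^sup>+\<omega>. e2ennreal (f (\<xi> \<omega>) x0) \<partial>M) = \<infinity>"
      \<comment> \<open>An infinite positive part makes the expectation infinite whatever the
        negative part, since \<open>\<infinity> - \<infinity> = \<infinity>\<close> in
        \<open>ereal\<close>.\<close>
      then have "objective M \<xi> f0 f x0 = \<infinity>" by (simp add: objective_def expectation_ereal_def)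
      with x0(2) show False by simp
    qed
    then have "AE \<omega> in M. e2ennreal (f (\<xi> \<omega>) x0) \<noteq> \<infinity>"
      using f_section_meas[OF x0(1)] by (intro nn_integral_PInf_AE) auto
    then have "AE \<omega> in M. \<not> Q (\<xi> \<omega>) x0"
      by eventually_elim (use f_Q[of _ x0] in \<open>auto simp: e2ennreal_infty\<close>)
    moreover have "{\<zeta> \<in> space (restrict_space borel \<Xi>). \<not> Q \<zeta> x0} \<in> sets (restrict_space borel \<Xi>)"
      using pred_intros_logic(2)[OF Q_x[OF x0(1)]]
      by (simp only: pred_def sets_L sets_eq_imp_space_eq[OF sets_L])
    ultimately have "AE \<zeta> in L. \<not> Q \<zeta> x0"
      unfolding L_def law_def by (subst AE_distr_iff[OF \<xi>])
    with good have "AE \<zeta> in L. f \<zeta> x0 < \<infinity>"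
      by eventually_elim (rule f_not_Q)
    then have "AE s in PiM {..<N} (\<lambda>_. L). f (s i) x0 < \<infinity>" if "i < N" for i
      using that by (intro AE_PiM_component L.prob_space_axioms) auto
    then have "AE s in PiM {..<N} (\<lambda>_. L). \<forall>i\<in>{..<N}. f (s i) x0 < \<infinity>"
      by (intro AE_finite_allI) auto
    then show ?thesis
      using AE_space
    proof eventually_elim
      case (elim s)
      then have "saa_feasible f X N s \<noteq> {}" using x0(1) by (auto simp: saa_feasible_def)
      then have "xstar s \<in> saa_feasible f X N s"
        using elim(2) by (intro xstar_feasible) (simp add: PL)
      then show ?case using f_Q by (fastforce simp: saa_feasible_def)
    qed
  qed

  have rays: "finite (extreme_rays (dual_cone_of (W \<zeta>)))"
    "card (extreme_rays (dual_cone_of (W \<zeta>))) \<le> k" if "\<zeta> \<in> \<Xi>" for \<zeta>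
  proof -
    show "finite (extreme_rays (dual_cone_of (W \<zeta>)))"
      using J_fin that by (simp add: J_finite_def)
    \<comment> \<open>A bounded set of naturals is finite, so \<open>Max\<close> is a genuine upper
      bound.\<close>
    have "finite ((\<lambda>\<zeta>. card (extreme_rays (dual_cone_of (W \<zeta>)))) ` \<Xi>)"
      using J_fin by (simp add: J_finite_def bdd_above_nat)
    then show "card (extreme_rays (dual_cone_of (W \<zeta>))) \<le> k"
      using that unfolding k_def J_card_def by (intro Max_ge) auto
  qed
  have growth: "card ((\<lambda>x. {i \<in> {..<2 * N}. Q (z i) x}) ` space S) \<le> (\<Sum>j\<le>CARD('n). (2 * N * k) choose j)"
    if "\<And>i. i < 2 * N \<Longrightarrow> z i \<in> space L" for z
    unfolding Q_def using that rays W_rows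
    by (intro card_infeasible_patterns_le) (auto simp: space_L)

  define E where "E \<epsilon> = {s \<in> space (PiM {..<N} (\<lambda>_. L)). \<epsilon> < measure L {\<zeta> \<in> space L. Q \<zeta> (xstar s)}}" for \<epsilon> :: real
  have E_eq: "{s \<in> space (sample_law M \<Xi> \<xi> N). violation M \<xi> f (xstar s) > \<epsilon>} = E \<epsilon>" for \<epsilon>
    using measurable_space[OF xs] viol by (auto simp: PL E_def space_S)
  have bound: "measure (PiM {..<N} (\<lambda>_. L)) (E \<epsilon>)
      \<le> 2 * exp (- (real N * \<epsilon>) / 4) * (12 / \<epsilon>) powr d_VC k CARD('n)"
    if \<epsilon>: "0 < \<epsilon>" "\<epsilon> < 1" for \<epsilon> :: real
  proof (cases "k = 0")
    case True
    \<comment> \<open>Without extreme rays the ray criterion rules out infeasibility, so no point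
      has a violation probability above \<open>\<epsilon>\<close>.\<close>
    have "\<not> Q \<zeta> x" if "\<zeta> \<in> \<Xi>" for \<zeta> x
    proof -
      have "extreme_rays (dual_cone_of (W \<zeta>)) = {}"
        using rays[OF that] True by simp
      then show ?thesis
        using infeasible_iff_extreme_ray[OF W_rows[OF that], of "h \<zeta> - T \<zeta> *v x"]
        by (simp add: Q_def eq_diff_eq)
    qed
    then have empty: "{\<zeta> \<in> space L. Q \<zeta> x} = {}" for x by (auto simp: space_L)
    have "E \<epsilon> = {}" using \<epsilon> unfolding E_def empty by simp
    then show ?thesis by simp
  next
    case False
    then have k: "1 \<le> k" by simp
    show ?thesis
    proof (cases "5 \<le> real N * \<epsilon>")
      case True
      let ?G = "\<Sum>j\<le>CARD('n). (2 * N * k) choose j"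
      have "measure (PiM {..<N} (\<lambda>_. L)) (E \<epsilon>) \<le> 2 * real ?G * 2 powr (- (real N * \<epsilon> / 2))"
        unfolding E_def
        by (rule L.consistent_selector_violation_bound[OF Q_meas xs cons True growth])
      then show ?thesis using growth_times_tail_le[OF k \<epsilon>, of N "CARD('n)"] by simp
    next
      case False
      \<comment> \<open>Below the threshold of \<open>hits_lower_tail\<close> the claimed bound
        exceeds 1: the exponential is at least \<open>exp (- 5 / 4)\<close>, hence at least 1/12,
        and the power is at least 12 because \<open>d_VC \<ge> 1\<close>.\<close>
      have "measure (PiM {..<N} (\<lambda>_. L)) (E \<epsilon>) \<le> 1" by (rule P.P.prob_le_1)
      also have "1 \<le> 2 * (1 / 12) * (12 :: real)" by simp
      also have "\<dots> \<le> 2 * exp (- (real N * \<epsilon>) / 4) * (12 / \<epsilon>) powr d_VC k CARD('n)"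
      proof (intro mult_mono)
        have "exp (5 / 4 :: real) \<le> exp 2" by simp
        also have "\<dots> = exp 1 * exp (1::real)" by (simp flip: exp_add)
        also have "\<dots> \<le> 3 * 3" using exp_le by (intro mult_mono) auto
        finally have "exp (5 / 4 :: real) \<le> 12" by simp
        then have "1 / 12 \<le> exp (- 5 / 4 :: real)" by (simp add: exp_minus field_simps)
        also have "\<dots> \<le> exp (- (real N * \<epsilon>) / 4)" using False by simp
        finally show "1 / 12 \<le> exp (- (real N * \<epsilon>) / 4)" .
        have "1 \<le> 2 * real k * (real CARD('n) + 1)"
          using k by (intro order_trans[OF _ mult_mono[of 2 "2 * real k" 1]]) auto
        then have d: "1 \<le> d_VC k CARD('n)" using d_VC_lower_bound[OF k, of "CARD('n)"] by linarith
        have "12 \<le> 12 / \<epsilon>" using \<epsilon> by (simp add: field_simps)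
        also have "\<dots> = (12 / \<epsilon>) powr 1" using \<epsilon> by simp
        also have "\<dots> \<le> (12 / \<epsilon>) powr d_VC k CARD('n)" using \<epsilon> d by (intro powr_mono) auto
        finally show "12 \<le> (12 / \<epsilon>) powr d_VC k CARD('n)" .
      qed auto
      finally show ?thesis .
    qed
  qed
  \<comment> \<open>The sample-size condition is the inequality between rate and
    \<open>\<delta>\<close> after taking logarithms.\<close>
  have rate: "2 * exp (- (real N * \<epsilon>) / 4) * (12 / \<epsilon>) powr d \<le> \<delta>"
    if \<epsilon>: "0 < \<epsilon>" "0 < \<delta>" and N: "4 / \<epsilon> * (d * ln (12 / \<epsilon>) + ln (2 / \<delta>)) \<le> real N" for \<epsilon> \<delta> d :: real
  proof -
    have "d * ln (12 / \<epsilon>) + ln (2 / \<delta>) \<le> real N * \<epsilon> / 4"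
      using N \<epsilon>(1) by (simp add: field_simps)
    then have "exp (d * ln (12 / \<epsilon>) - real N * \<epsilon> / 4) \<le> exp (- ln (2 / \<delta>))" by simp
    also have "\<dots> = \<delta> / 2" using \<epsilon>(2) by (simp add: exp_minus)
    also have "exp (d * ln (12 / \<epsilon>) - real N * \<epsilon> / 4) = exp (- (real N * \<epsilon>) / 4) * (12 / \<epsilon>) powr d"
      using \<epsilon>(1) by (simp add: powr_def flip: exp_add)
    finally show ?thesis by simp
  qed
  show ?thesis
    unfolding Let_def E_eq k_def[symmetric] unfolding PL
    using bound rate by (blast intro: order_trans)
qed

end
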